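(* Let $\mathbb{T}$ be a time scale, $\alpha\in(0,1]$, $t_0\in\mathbb{T}$, $a,b\in\mathbb{R}$. Let $\kappa_0,\kappa_1$ be an admissible pair on $\mathbb{T}$, and let $\Delta^{\alpha}f=\kappa_1(\alpha,\cdot)f+\kappa_0(\alpha,\cdot)f^{\Delta}$. Suppose that the equation $$\Delta^{\alpha}\Delta^{\alpha}y(t)+a\Delta^{\alpha}y(t)+by(t)=0,\qquad t\in\mathbb{T}^{\kappa^2}_{[t_0,\infty)},\qquad(\ast)$$ is regressive, i.e., $\kappa_0^{2}-\mu\kappa_0(a+2\kappa_1)+\mu^{2}(b+a\kappa_1+\kappa_1^{2})\neq0$ for all $t\in\mathbb{T}^{\kappa}$, where $\kappa_i=\kappa_i(\alpha,t)$, $\mu=\mu(t)$, and that $a^2-4b\neq0$. Then $E_{\lambda_1}(\cdot,t_0)$ and $E_{\lambda_2}(\cdot,t_0)$ form a fundamental system of $(\ast)$, where $$\lambda_1=\frac{-a-\sqrt{a^2-4b}}{2},\qquad \lambda_2=\frac{-a+\sqrt{a^2-4b}}{2},$$ and the solution of the initial value problem consisting of $(\ast)$ together with $y(t_0)=y_0$, $\Delta^{\alpha}y(t_0)=y_0^{\alpha}$ is given by $$y(t)=y_0\,\frac{E_{\lambda_1}(t,t_0)+E_{\lambda_2}(t,t_0)}{2}+\frac{ay_0+2y_0^{\alpha}}{\sqrt{a^2-4b}}\cdot\frac{E_{\lambda_2}(t,t_0)-E_{\lambda_1}(t,t_0)}{2},\qquad t\in\mathbb{T}^{\kappa^2}_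{[t_0,\infty)}.$$
   Context: A time scale $\mathbb{T}$ is a nonempty closed subset of $\mathbb{R}$, with forward jump $\sigma(t)=\inf\{s\in\mathbb{T}:s>t\}$, backward jump $\rho(t)=\sup\{s\in\mathbb{T}:s<t\}$ (usual conventions $\inf\emptyset=\sup\mathbb{T}$, $\sup\emptyset=\inf\mathbb{T}$) and graininess $\mu(t)=\sigma(t)-t$. A point $t$ is right-dense if $t<\sup\mathbb{T}$ and $\sigma(t)=t$, left-dense if $t>\inf\mathbb{T}$ and $\rho(t)=t$, left-scattered if $\rho(t)<t$. $\mathbb{T}^{\kappa}=\mathbb{T}\setminus\{m\}$ if $\mathbb{T}$ has a left-scattered maximum $m$, and $\mathbb{T}^{\kappa}=\mathbb{T}$ otherwise; $\mathbb{T}^{\kappa^2}=(\mathbb{T}^\kappa)^\kappa$. A subscript $[t_0,\infty)$ denotes intersection with $[t_0,\infty)$. Delta derivative: for $t\in\mathbb{T}^\kappa$, $f^{\Delta}(t)$ is the number (if it exists) such that for every $\epsilon>0$ there is $\delta>0$ with $|[f(\sigma(t))-f(s)]-f^{\Delta}(t)[\sigma(t)-s]|\le\epsilon|\sigma(t)-s|$ for all $s\in(t-\delta,t+\delta)\cap\mathbb{T}$ (likewise for complex-valued functions). A function on $\mathbb{T}$ is rd-continuous if it is continuous at right-dense points and has finite left-sided limits at left-dense points. A function $k:[0,1]\times\mathbb{T}\to[0,\infty)$ is rd-continuous if $k(\alpha,\cdot)$ is rd-continuous for every $\alpha\in[0,1]$ and $k(\cdot,t)$ is continuous on $[0,1]$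 for every $t\in\mathbb{T}$. Admissible pair: rd-continuous $\kappa_0,\kappa_1:[0,1]\times\mathbb{T}\to[0,\infty)$ such that for all $t\in\mathbb{T}$: $\lim_{\alpha\to0^+}\kappa_1(\alpha,t)=1$, $\lim_{\alpha\to0^+}\kappa_0(\alpha,t)=0$, $\lim_{\alpha\to1^-}\kappa_1(\alpha,t)=0$, $\lim_{\alpha\to1^-}\kappa_0(\alpha,t)=1$, $\kappa_1(\alpha,t)\ne0$ for $\alpha\in[0,1)$, $\kappa_0(\alpha,t)\neq0$ for $\alpha\in(0,1]$. Exponentials: $e_q(t,s)=\exp\left(\int_s^t\xi_{\mu(\tau)}(q(\tau))\Delta\tau\right)$ (delta integral) denotes the usual exponential function on the time scale, with $\xi_h(z)=\frac1h\mathrm{Log}(1+hz)$ for $h>0$ ($\mathrm{Log}$ the principal logarithm) and $\xi_0(z)=z$. For $\lambda\in\mathbb{C}$ with $1+\mu(t)\frac{\lambda-\kappa_1(\alpha,t)}{\kappa_0(\alpha,t)}\ne0$ for all $t\in\mathbb{T}^\kappa$, and $s\le t$ in $\mathbb{T}$, $E_\lambda(t,s)=e_q(t,s)$ with $q=\frac{\lambda-\kappa_1(\alpha,\cdot)}{\kappa_0(\alpha,\cdot)}$; regressivity of $(\ast)$ ensures this nonvanishing for $\lambda=\lambda_1,\lambda_2$. Two solutions $y_1,y_2$ of $(\ast)$ form a fundamental system (set) of solutions if the Wronskian $W(y_1,y_2)(t)=y_1(t)\Delta^\alpha y_2(t)-y_2(t)\Delta^\alpha y_1(t)$ is nonzero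 for all $t\in\mathbb{T}^{\kappa^2}_{[t_0,\infty)}$. Here $y_0$ and $y_0^\alpha$ are given constants.
   Formalization: Added assumptions: the quotients (λ_i−κ_1)/κ_0 are rd-continuous (otherwise the exponentials may be undefined), and κ_0(α,·), κ_1(α,·) are continuous at the maximum of T^κ when it exists and is left-dense (otherwise the claim fails for a jump there). *)

theory Defs
  imports "HOL-Analysis.Analysis"
begin

section \<open>Time scales\<close>

definition time_scale :: "real set \<Rightarrow> bool" where
  "time_scale T \<longleftrightarrow> T \<noteq> {} \<and> closed T"

text \<open>
  For \<open>t \<in> T\<close> the conventions \<open>inf {} = sup T\<close> and \<open>sup {} = inf T\<close> are only used when \<open>t\<close> is
  the maximum (minimum) of \<open>T\<close>, so the real-valued \<open>Sup\<close> and \<open>Inf\<close> never meet an unbounded set.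
\<close>

definition sigma :: "real set \<Rightarrow> real \<Rightarrow> real" where
  "sigma T t = (if {s \<in> T. t < s} = {} then Sup T else Inf {s \<in> T. t < s})"

definition rho :: "real set \<Rightarrow> real \<Rightarrow> real" where
  "rho T t = (if {s \<in> T. s < t} = {} then Inf T else Sup {s \<in> T. s < t})"

definition graininess :: "real set \<Rightarrow> real \<Rightarrow> real" where
  "graininess T t = sigma T t - t"

text \<open>\<open>t < sup T\<close> and \<open>inf T < t\<close> are meant in the extended reals, hence the existential form.\<close>

definition right_dense :: "real set \<Rightarrow> real \<Rightarrow> bool" where
  "right_dense T t \<longleftrightarrow> t \<in> T \<and> (\<exists>s\<in>T. t < s) \<and> sigma T t = t"

definition left_dense :: "real set \<Rightarrow> real \<Rightarrow> bool" where
  "left_dense T t \<longleftrightarrow> t \<in> T \<and> (\<exists>s\<in>T. s < t) \<and> rho T t = t"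

definition left_scattered :: "real set \<Rightarrow> real \<Rightarrow> bool" where
  "left_scattered T t \<longleftrightarrow> t \<in> T \<and> rho T t < t"

definition is_maximum :: "real set \<Rightarrow> real \<Rightarrow> bool" where
  "is_maximum T m \<longleftrightarrow> m \<in> T \<and> (\<forall>s\<in>T. s \<le> m)"

definition ts_kappa :: "real set \<Rightarrow> real set" where
  "ts_kappa T = T - {m. is_maximum T m \<and> left_scattered T m}"

section \<open>Delta calculus\<close>

text \<open>
  A relation rather than a function: on a one-point time scale every \<open>D\<close> is a delta derivative, and
  such a time scale can occur as \<open>ts_kappa T\<close>.
\<close>

definition has_delta_derivative ::
  "real set \<Rightarrow> (real \<Rightarrow> 'a::real_normed_vector) \<Rightarrow> 'a \<Rightarrow> real \<Rightarrow> bool" where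
  "has_delta_derivative T f D t \<longleftrightarrow>
     (\<forall>\<epsilon>>0. \<exists>\<delta>>0. \<forall>s \<in> {t - \<delta><..<t + \<delta>} \<inter> T.
        norm ((f (sigma T t) - f s) - (sigma T t - s) *\<^sub>R D) \<le> \<epsilon> * \<bar>sigma T t - s\<bar>)"

definition rd_continuous :: "real set \<Rightarrow> (real \<Rightarrow> 'a::topological_space) \<Rightarrow> bool" where
  "rd_continuous T f \<longleftrightarrow>
     (\<forall>t. right_dense T t \<longrightarrow> continuous (at t within T) f) \<and>
     (\<forall>t. left_dense T t \<longrightarrow> (\<exists>l. (f \<longlongrightarrow> l) (at t within T \<inter> {..<t})))"

definition delta_antiderivative ::
  "real set \<Rightarrow> (real \<Rightarrow> 'a::real_normed_vector) \<Rightarrow> (real \<Rightarrow> 'a) \<Rightarrow> bool" where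
  "delta_antiderivative T f F \<longleftrightarrow> (\<forall>t \<in> ts_kappa T. has_delta_derivative T F (f t) t)"

text \<open>The Cauchy delta integral; any two antiderivatives differ by a constant on \<open>T\<close>.\<close>

definition delta_integral ::
  "real set \<Rightarrow> (real \<Rightarrow> 'a::real_normed_vector) \<Rightarrow> real \<Rightarrow> real \<Rightarrow> 'a" where
  "delta_integral T f s t = (THE I. \<exists>F. delta_antiderivative T f F \<and> I = F t - F s)"

definition cylinder :: "real \<Rightarrow> complex \<Rightarrow> complex" where
  "cylinder h z = (if h = 0 then z else Ln (1 + of_real h * z) / of_real h)"

definition ts_exp :: "real set \<Rightarrow> (real \<Rightarrow> complex) \<Rightarrow> real \<Rightarrow> real \<Rightarrow> complex" where
  "ts_exp T q t s = exp (delta_integral T (\<lambda>\<tau>. cylinder (graininess T \<tau>) (q \<tau>)) s t)"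

text \<open>
  By definition a left-dense maximum is not right-dense, so rd-continuity permits a jump there. But
  the delta derivative at such a point sees only the left-sided limit. For a first derivative this
  concerns the maximum of \<open>T\<close>; for a second one, which is formed on the time scale \<open>ts_kappa T\<close>,
  it concerns the maximum of \<open>ts_kappa T\<close> (which is that of \<open>T\<close> when the latter is left-dense).
\<close>

definition continuous_at_left_dense_end :: "real set \<Rightarrow> (real \<Rightarrow> 'a::topological_space) \<Rightarrow> bool" where
  "continuous_at_left_dense_end T f \<longleftrightarrow>
     (\<forall>m. is_maximum (ts_kappa T) m \<and> left_dense T m \<longrightarrow> continuous (at m within T) f)"

section \<open>Conformable derivative and second order equations\<close>

definition rd_continuous_kernel :: "real set \<Rightarrow> (real \<Rightarrow> real \<Rightarrow> real) \<Rightarrow> bool" where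
  "rd_continuous_kernel T k \<longleftrightarrow>
     (\<forall>\<alpha>\<in>{0..1}. \<forall>t\<in>T. 0 \<le> k \<alpha> t) \<and>
     (\<forall>\<alpha>\<in>{0..1}. rd_continuous T (k \<alpha>)) \<and>
     (\<forall>t\<in>T. continuous_on {0..1} (\<lambda>\<alpha>. k \<alpha> t))"

definition admissible_pair ::
  "real set \<Rightarrow> (real \<Rightarrow> real \<Rightarrow> real) \<Rightarrow> (real \<Rightarrow> real \<Rightarrow> real) \<Rightarrow> bool" where
  "admissible_pair T \<kappa>0 \<kappa>1 \<longleftrightarrow>
     rd_continuous_kernel T \<kappa>0 \<and> rd_continuous_kernel T \<kappa>1 \<and>
     (\<forall>t\<in>T.
        ((\<lambda>\<alpha>. \<kappa>1 \<alpha> t) \<longlongrightarrow> 1) (at_right 0) \<and>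
        ((\<lambda>\<alpha>. \<kappa>0 \<alpha> t) \<longlongrightarrow> 0) (at_right 0) \<and>
        ((\<lambda>\<alpha>. \<kappa>1 \<alpha> t) \<longlongrightarrow> 0) (at_left 1) \<and>
        ((\<lambda>\<alpha>. \<kappa>0 \<alpha> t) \<longlongrightarrow> 1) (at_left 1) \<and>
        (\<forall>\<alpha>\<in>{0..<1}. \<kappa>1 \<alpha> t \<noteq> 0) \<and>
        (\<forall>\<alpha>\<in>{0<..1}. \<kappa>0 \<alpha> t \<noteq> 0))"

definition has_alpha_derivative ::
  "real set \<Rightarrow> (real \<Rightarrow> real \<Rightarrow> real) \<Rightarrow> (real \<Rightarrow> real \<Rightarrow> real) \<Rightarrow> real \<Rightarrow>
   (real \<Rightarrow> complex) \<Rightarrow> complex \<Rightarrow> real \<Rightarrow> bool" where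
  "has_alpha_derivative T \<kappa>0 \<kappa>1 \<alpha> f D t \<longleftrightarrow>
     (\<exists>d. has_delta_derivative T f d t \<and>
          D = of_real (\<kappa>1 \<alpha> t) * f t + of_real (\<kappa>0 \<alpha> t) * d)"

definition exp_quotient ::
  "(real \<Rightarrow> real \<Rightarrow> real) \<Rightarrow> (real \<Rightarrow> real \<Rightarrow> real) \<Rightarrow> real \<Rightarrow> complex \<Rightarrow> real \<Rightarrow> complex" where
  "exp_quotient \<kappa>0 \<kappa>1 \<alpha> lam t = (lam - of_real (\<kappa>1 \<alpha> t)) / of_real (\<kappa>0 \<alpha> t)"

definition alpha_exp ::
  "real set \<Rightarrow> (real \<Rightarrow> real \<Rightarrow> real) \<Rightarrow> (real \<Rightarrow> real \<Rightarrow> real) \<Rightarrow> real \<Rightarrow>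
   complex \<Rightarrow> real \<Rightarrow> real \<Rightarrow> complex" where
  "alpha_exp T \<kappa>0 \<kappa>1 \<alpha> lam t s = ts_exp T (exp_quotient \<kappa>0 \<kappa>1 \<alpha> lam) t s"

definition regressive_equation ::
  "real set \<Rightarrow> (real \<Rightarrow> real \<Rightarrow> real) \<Rightarrow> (real \<Rightarrow> real \<Rightarrow> real) \<Rightarrow> real \<Rightarrow> real \<Rightarrow> real \<Rightarrow> bool" where
  "regressive_equation T \<kappa>0 \<kappa>1 \<alpha> a b \<longleftrightarrow>
     (\<forall>t \<in> ts_kappa T.
        (\<kappa>0 \<alpha> t)\<^sup>2 - graininess T t * \<kappa>0 \<alpha> t * (a + 2 * \<kappa>1 \<alpha> t)
          + (graininess T t)\<^sup>2 * (b + a * \<kappa>1 \<alpha> t + (\<kappa>1 \<alpha> t)\<^sup>2) \<noteq> 0)"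

text \<open>
  \<open>y\<close> solves the equation on the half line from \<open>t0\<close>, and \<open>v\<close> is its first derivative of order
  \<open>\<alpha>\<close>. A solution is a function on \<open>T \<inter> {t0..}\<close>, so derivatives are taken on that time scale; this
  matters only at \<open>t0\<close>. The derivative \<open>v\<close> lives on \<open>ts_kappa T \<inter> {t0..}\<close> and is
  differentiated there.
\<close>

definition solves_equation ::
  "real set \<Rightarrow> (real \<Rightarrow> real \<Rightarrow> real) \<Rightarrow> (real \<Rightarrow> real \<Rightarrow> real) \<Rightarrow> real \<Rightarrow> real \<Rightarrow> real \<Rightarrow> real \<Rightarrow>
   (real \<Rightarrow> complex) \<Rightarrow> (real \<Rightarrow> complex) \<Rightarrow> bool" where
  "solves_equation T \<kappa>0 \<kappa>1 \<alpha> a b t0 y v \<longleftrightarrow>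
     (\<forall>t \<in> ts_kappa T \<inter> {t0..}. has_alpha_derivative (T \<inter> {t0..}) \<kappa>0 \<kappa>1 \<alpha> y (v t) t) \<and>
     (\<forall>t \<in> ts_kappa (ts_kappa T) \<inter> {t0..}.
        \<exists>w. has_alpha_derivative (ts_kappa T \<inter> {t0..}) \<kappa>0 \<kappa>1 \<alpha> v w t \<and>
            w + of_real a * v t + of_real b * y t = 0)"

definition solves_ivp ::
  "real set \<Rightarrow> (real \<Rightarrow> real \<Rightarrow> real) \<Rightarrow> (real \<Rightarrow> real \<Rightarrow> real) \<Rightarrow> real \<Rightarrow> real \<Rightarrow> real \<Rightarrow> real \<Rightarrow>
   complex \<Rightarrow> complex \<Rightarrow> (real \<Rightarrow> complex) \<Rightarrow> bool" where
  "solves_ivp T \<kappa>0 \<kappa>1 \<alpha> a b t0 y0 y0\<alpha> y \<longleftrightarrow>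
     (\<exists>v. solves_equation T \<kappa>0 \<kappa>1 \<alpha> a b t0 y v \<and> y t0 = y0 \<and> v t0 = y0\<alpha>)"

definition fundamental_system ::
  "real set \<Rightarrow> (real \<Rightarrow> real \<Rightarrow> real) \<Rightarrow> (real \<Rightarrow> real \<Rightarrow> real) \<Rightarrow> real \<Rightarrow> real \<Rightarrow> real \<Rightarrow> real \<Rightarrow>
   (real \<Rightarrow> complex) \<Rightarrow> (real \<Rightarrow> complex) \<Rightarrow> bool" where
  "fundamental_system T \<kappa>0 \<kappa>1 \<alpha> a b t0 y1 y2 \<longleftrightarrow>
     (\<exists>v1 v2. solves_equation T \<kappa>0 \<kappa>1 \<alpha> a b t0 y1 v1 \<and>
              solves_equation T \<kappa>0 \<kappa>1 \<alpha> a b t0 y2 v2 \<and>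
              (\<forall>t \<in> ts_kappa (ts_kappa T) \<inter> {t0..}. y1 t * v2 t - y2 t * v1 t \<noteq> 0))"

end

theory Submission
  imports Defs
begin

text \<open>
  Since \<open>lam1\<close> and \<open>lam2\<close> are the roots of \<open>z\<^sup>2 + a z + b\<close>, the operator of the equation factors as
  \<open>(\<Delta>\<^sup>\<alpha> - lam1) (\<Delta>\<^sup>\<alpha> - lam2)\<close>, in either order. The first order equation \<open>\<Delta>\<^sup>\<alpha> u = lam u\<close> says
  \<open>u\<^sup>\<Delta> = q u\<close> with \<open>q = (lam - \<kappa>1) / \<kappa>0\<close>, and the exponential function of \<open>q\<close> solves it.

  \<^bold>\<open>Existence.\<close> The exponential \<open>E\<close> is \<open>exp F\<close> for an antiderivative \<open>F\<close> of the cylinder transform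
  of \<open>q\<close>. The antiderivative is the ordinary integral of the step function that extends the
  integrand from \<open>T\<close> to the reals; this function is regulated, hence integrable
  (\<open>mean_value_primitive_exists\<close>). At a point with \<open>\<sigma>(t) = t\<close> the equation \<open>E\<^sup>\<Delta> = q E\<close> is the
  chain rule; at a right-scattered point it is \<open>E (\<sigma> t) = (1 + \<mu> q) E t\<close>, which holds because
  \<open>1 + \<mu> q \<noteq> 0\<close> (\<open>ts_exp_delta_derivative\<close>). The regressivity hypothesis is the product of these
  two conditions for \<open>lam1\<close> and \<open>lam2\<close>, up to the factor \<open>\<kappa>0\<^sup>2\<close>. The second derivative is formed
  on \<open>ts_kappa T\<close>, whose maximum may be left-dense there and right-scattered in \<open>T\<close>; at such a
  point the derivative of \<open>E\<close> on \<open>ts_kappa T\<close> is governed by the left limit of \<open>q\<close>, and the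
  continuity of \<open>\<kappa>0\<close> and \<open>\<kappa>1\<close> makes it \<open>q E\<close> again (\<open>ts_exp_delta_derivative_kappa\<close>).

  \<^bold>\<open>Uniqueness.\<close> If \<open>y\<close> is a solution with first derivative \<open>v\<close>, the factorization shows that
  \<open>v - lam1 y\<close> solves the first order equation of \<open>lam2\<close>. Its quotient by the exponential of
  \<open>lam2\<close> has delta derivative zero, so it is constant
  (\<open>delta_derivative_zero_constant\<close>, \<open>solution_factor\<close>). The same holds with the roots exchanged,
  and \<open>(lam2 - lam1) y\<close> is the difference of the two functions so determined. Since
  \<open>lam2 - lam1 = r \<noteq> 0\<close>, this fixes \<open>y\<close>; the Wronskian of the exponentials is \<open>r\<close> times their
  product, which has no zeros.
\<close>

section \<open>The forward jump\<close>

lemma sigma_eq_self: "sigma T t = t" if "t \<in> T" "\<And>s. s \<in> T \<Longrightarrow> s \<le> t"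
proof -
  have "{s \<in> T. t < s} = {}" using that(2) by force
  moreover have "Sup T = t" using that by (intro cSup_eq_maximum) auto
  ultimately show ?thesis by (simp add: sigma_def)
qed

lemma sigma_eq_Inf: "sigma T t = Inf {s \<in> T. t < s}" if "u \<in> T" "t < u"
  using that unfolding sigma_def by auto

lemma sigma_le: "sigma T t \<le> u" if "u \<in> T" "t < u"
  unfolding sigma_eq_Inf[OF that]
  by (rule cInf_lower) (use that in \<open>auto intro!: bdd_belowI[of _ t]\<close>)

lemma sigma_ge: "t \<le> sigma T t" if "t \<in> T"
proof (cases "\<exists>u\<in>T. t < u")
  case True
  then obtain u where u: "u \<in> T" "t < u" by blast
  show ?thesis unfolding sigma_eq_Inf[OF u] by (rule cInf_greatest) (use u in auto)
next
  case False
  then show ?thesis using sigma_eq_self[of t T] that by (auto simp: not_less)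
qed

lemma sigma_in: "sigma T t \<in> T" if "closed T" "t \<in> T"
proof (cases "\<exists>u\<in>T. t < u")
  case True
  then obtain u where u: "u \<in> T" "t < u" by blast
  have "Inf {s \<in> T. t < s} \<in> closure {s \<in> T. t < s}"
    by (rule closure_contains_Inf) (use u in \<open>auto intro!: bdd_belowI[of _ t]\<close>)
  also have "\<dots> \<subseteq> T" using that(1) by (intro closure_minimal) auto
  finally show ?thesis unfolding sigma_eq_Inf[OF u] .
next
  case False
  then show ?thesis using sigma_eq_self[of t T] that by (auto simp: not_less)
qed

lemma graininess_nonneg: "0 \<le> graininess T t" if "t \<in> T"
  using sigma_ge[OF that] by (simp add: graininess_def)

lemma right_dense_approach: "\<exists>u\<in>T. t < u \<and> u < t + e" if rd: "right_dense T t" and "0 < e"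
proof -
  have *: "sigma T t = t" using that by (simp add: right_dense_def)
  obtain u where u: "u \<in> T" "t < u" using rd by (auto simp: right_dense_def)
  have "Inf {s \<in> T. t < s} < t + e" using * that sigma_eq_Inf[OF u] by simp
  then obtain x where "x \<in> {s \<in> T. t < s}" "x < t + e"
    using u by (metis (no_types, lifting) cInf_lessD empty_iff mem_Collect_eq)
  then show ?thesis by blast
qed

lemma sigma_half_line: "sigma (T \<inter> {t0..}) t = sigma T t" if "t \<in> T" "t0 \<le> t"
proof (cases "\<exists>u\<in>T. t < u")
  case True
  then obtain u where u: "u \<in> T" "t < u" by blast
  have "{s \<in> T \<inter> {t0..}. t < s} = {s \<in> T. t < s}" using that by auto
  then show ?thesis using sigma_eq_Inf[OF u] sigma_eq_Inf[of u "T \<inter> {t0..}" t] u that by auto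
next
  case False
  then show ?thesis using sigma_eq_self[of t T] sigma_eq_self[of t "T \<inter> {t0..}"] that
    by (auto simp: not_less)
qed

lemma ts_kappa_subset: "ts_kappa T \<subseteq> T"
  by (auto simp: ts_kappa_def)

lemma not_in_ts_kappa: "is_maximum T s" if "s \<in> T" "s \<notin> ts_kappa T"
  using that by (auto simp: ts_kappa_def)

lemma later_in_ts_kappa: "t \<in> ts_kappa T" if "t \<in> T" "u \<in> T" "t < u"
  using that by (force simp: ts_kappa_def is_maximum_def)

text \<open>
  The only point that \<open>ts_kappa\<close> can remove is the maximum, so as long as some point of
  \<open>ts_kappa T\<close> lies beyond \<open>t\<close>, the successor of \<open>t\<close> is not the removed one.
\<close>

lemma sigma_ts_kappa: "sigma (ts_kappa T) t = sigma T t" if u: "u \<in> ts_kappa T" "t < u"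
proof -
  let ?A = "{s \<in> T. t < s}" and ?B = "{s \<in> ts_kappa T. t < s}"
  have uT: "u \<in> T" using u ts_kappa_subset by blast
  have bdd: "bdd_below ?A" "bdd_below ?B" by (auto intro!: bdd_belowI[of _ t])
  have "Inf ?A \<le> Inf ?B"
    using u ts_kappa_subset by (intro cInf_superset_mono bdd) auto
  moreover have "Inf ?B \<le> Inf ?A"
  proof (rule cInf_mono[OF _ bdd(2)])
    show "?A \<noteq> {}" using u uT by auto
    fix s assume s: "s \<in> ?A"
    show "\<exists>x\<in>?B. x \<le> s"
    proof (cases "s \<in> ts_kappa T")
      case False
      then have "u \<le> s" using not_in_ts_kappa s uT by (auto simp: is_maximum_def)
      then show ?thesis using u by auto
    qed (use s in auto)
  qed
  ultimately show ?thesis using sigma_eq_Inf[OF u] sigma_eq_Inf[OF uT u(2)] by simp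
qed

text \<open>
  A left-scattered maximum is isolated: removing it cuts \<open>T\<close> off at its predecessor.
\<close>

lemma closed_ts_kappa: "closed (ts_kappa T)" if "closed T"
proof (cases "\<exists>m. is_maximum T m \<and> left_scattered T m")
  case True
  then obtain m where m: "is_maximum T m" "left_scattered T m" by blast
  have "ts_kappa T = T \<inter> {..rho T m}"
  proof (intro equalityI subsetI)
    fix s assume s: "s \<in> ts_kappa T"
    then have "s \<in> T" "s \<noteq> m" using m by (auto simp: ts_kappa_def)
    then have "s < m" using m by (auto simp: is_maximum_def less_le)
    then have "s \<le> rho T m" using \<open>s \<in> T\<close> unfolding rho_def
      by (auto intro!: cSup_upper bdd_aboveI[of _ m])
    then show "s \<in> T \<inter> {..rho T m}" using \<open>s \<in> T\<close> by simp
  next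
    fix s assume "s \<in> T \<inter> {..rho T m}"
    then have "s \<in> T" "s < m" using m by (auto simp: left_scattered_def)
    then show "s \<in> ts_kappa T" using m by (intro later_in_ts_kappa[of s T m]) (auto simp: is_maximum_def)
  qed
  then show ?thesis using that by auto
next
  case False
  then have "ts_kappa T = T" by (auto simp: ts_kappa_def)
  then show ?thesis using that by simp
qed

lemma at_within_approach:
  fixes t :: real
  assumes "at t within A \<noteq> bot" "0 < e"
  shows "\<exists>s\<in>A. s \<noteq> t \<and> \<bar>s - t\<bar> < e"
  using assms unfolding trivial_limit_within islimpt_approachable dist_real_def by blast

lemma left_dense_if_limit: "left_dense T t"
  if t: "t \<in> T" and lim: "at t within (T \<inter> {..<t}) \<noteq> bot"
proof -
  have app: "\<exists>s\<in>T. s < t \<and> t - e < s" if "0 < e" for e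
  proof -
    obtain s where "s \<in> T" "s < t" "\<bar>s - t\<bar> < e" using at_within_approach[OF lim \<open>0 < e\<close>] by auto
    then show ?thesis by (intro bexI[of _ s]) auto
  qed
  obtain s where s: "s \<in> T" "s < t" using app[of 1] by auto
  have "Sup {s \<in> T. s < t} = t"
  proof (rule cSup_eq_non_empty)
    show "{s \<in> T. s < t} \<noteq> {}" using s by auto
    show "x \<le> t" if "x \<in> {s \<in> T. s < t}" for x using that by simp
    fix y assume y: "\<And>x. x \<in> {s \<in> T. s < t} \<Longrightarrow> x \<le> y"
    show "t \<le> y"
    proof (rule ccontr)
      assume "\<not> t \<le> y"
      then have "0 < t - y" by simp
      from app[OF this] obtain x where "x \<in> T" "x < t" "t - (t - y) < x" by blast
      then show False using y[of x] by simp
    qed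
  qed
  then show ?thesis using s t unfolding left_dense_def rho_def by auto
qed

lemma at_within_maximum: "at m within T = at m within (T \<inter> {..<m})" if "is_maximum T m"
  by (rule at_within_nhd[of _ UNIV]) (use that in \<open>auto simp: is_maximum_def less_le\<close>)

lemma not_in_ts_kappa_isolated: "at t within T = bot" if t: "t \<in> T" "t \<notin> ts_kappa T"
proof (rule ccontr)
  have m: "is_maximum T t" "left_scattered T t" using t by (auto simp: ts_kappa_def)
  assume "at t within T \<noteq> bot"
  then have "left_dense T t"
    using left_dense_if_limit t(1) at_within_maximum[OF m(1)] by simp
  then show False using m by (simp add: left_dense_def left_scattered_def)
qed

section \<open>Delta derivatives as ordinary derivatives or jumps\<close>

text \<open>
  Every later computation with delta derivatives rests on the following dichotomy. It is stated for
  \<open>sigma T t = t\<close> and not for right-dense points, so that it also covers the maximum of \<open>T\<close>.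
\<close>

lemma has_delta_derivative_dense:
  assumes "sigma T t = t"
  shows "has_delta_derivative T f D t \<longleftrightarrow> (f has_vector_derivative D) (at t within T)"
proof -
  have *: "norm (f t - f y - (t - y) *\<^sub>R D) = norm (f y - f t - (y - t) *\<^sub>R D)" for y
  proof -
    have "f t - f y - (t - y) *\<^sub>R D = - (f y - f t - (y - t) *\<^sub>R D)"
      by (simp add: algebra_simps)
    then show ?thesis by (metis norm_minus_cancel)
  qed
  have **: "(\<forall>s\<in>{t - d<..<t + d} \<inter> T. P s) \<longleftrightarrow> (\<forall>s\<in>T. \<bar>s - t\<bar> < d \<longrightarrow> P s)" for d P
    by (auto simp: abs_less_iff)
  show ?thesis
    unfolding has_delta_derivative_def has_vector_derivative_def has_derivative_within_alt assms * **
    by (auto simp: bounded_linear_scaleR_left abs_minus_commute)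
qed

text \<open>
  At a right-scattered point the right-hand side \<open>\<epsilon> * \<bar>sigma T t - s\<bar>\<close> of the definition stays
  away from zero as \<open>s\<close> tends to \<open>t\<close>. The condition therefore says that the remainder vanishes at
  \<open>t\<close> itself, which gives the jump, and is continuous there.
\<close>

lemma has_delta_derivative_scattered:
  assumes t: "t \<in> T" and jump: "t < sigma T t"
  shows "has_delta_derivative T f D t \<longleftrightarrow>
    continuous (at t within T) f \<and> f (sigma T t) - f t = (sigma T t - t) *\<^sub>R D"
proof -
  define h where "h s = (f (sigma T t) - f s) - (sigma T t - s) *\<^sub>R D" for s
  define m where "m = sigma T t - t"
  have m: "0 < m" using jump by (simp add: m_def)
  have f_h: "f s = f (sigma T t) - (sigma T t - s) *\<^sub>R D - h s" for s
    by (simp add: h_def)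
  show ?thesis
  proof
    assume D: "has_delta_derivative T f D t"
    have D': "\<exists>d>0. \<forall>s\<in>{t - d<..<t + d} \<inter> T. norm (h s) \<le> e * \<bar>sigma T t - s\<bar>" if "0 < e" for e
      using D that unfolding has_delta_derivative_def h_def by blast
    have "norm (h t) \<le> 0"
    proof (rule field_le_epsilon)
      fix e :: real assume "0 < e"
      then have "0 < e / m" using m by simp
      from D'[OF this] obtain d where "d > 0"
        "\<forall>s\<in>{t - d<..<t + d} \<inter> T. norm (h s) \<le> e / m * \<bar>sigma T t - s\<bar>" by blast
      then have "norm (h t) \<le> e / m * \<bar>sigma T t - t\<bar>" using t by auto
      then show "norm (h t) \<le> 0 + e" using m by (simp add: m_def)
    qed
    then have ht: "h t = 0" by simp
    have "(h \<longlongrightarrow> 0) (at t within T)"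
    proof (rule tendstoI)
      fix e :: real assume "0 < e"
      define e' where "e' = e / (2 * (m + 1))"
      have "0 < e'" using m \<open>0 < e\<close> by (simp add: e'_def)
      from D'[OF this] obtain d where d: "d > 0"
        "\<forall>s\<in>{t - d<..<t + d} \<inter> T. norm (h s) \<le> e' * \<bar>sigma T t - s\<bar>" by blast
      have "norm (h s) < e" if "s \<in> T" "dist s t < min d 1" for s
      proof -
        have "s \<in> {t - d<..<t + d} \<inter> T" using that by (auto simp: dist_real_def abs_less_iff)
        then have "norm (h s) \<le> e' * \<bar>sigma T t - s\<bar>" using d by blast
        also have "\<dots> \<le> e' * (m + 1)"
          using \<open>0 < e'\<close> that m by (intro mult_left_mono) (auto simp: m_def dist_real_def)
        also have "\<dots> = e / 2" using m by (simp add: e'_def divide_simps)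
        also have "\<dots> < e" using \<open>0 < e\<close> by simp
        finally show ?thesis .
      qed
      then show "\<forall>\<^sub>F s in at t within T. dist (h s) 0 < e"
        unfolding eventually_at using \<open>d > 0\<close> by (intro exI[of _ "min d 1"]) auto
    qed
    then have "continuous (at t within T) h" by (simp add: continuous_within ht)
    then have "continuous (at t within T) f"
      by (subst f_h[abs_def]) (intro continuous_intros)
    then show "continuous (at t within T) f \<and> f (sigma T t) - f t = (sigma T t - t) *\<^sub>R D"
      using ht by (simp add: h_def)
  next
    assume *: "continuous (at t within T) f \<and> f (sigma T t) - f t = (sigma T t - t) *\<^sub>R D"
    then have "continuous (at t within T) h" and ht: "h t = 0"
      unfolding h_def[abs_def] by (auto intro!: continuous_intros)
    then have lim: "\<forall>e>0. \<exists>d>0. \<forall>s\<in>T. dist s t < d \<longrightarrow> dist (h s) (h t) < e"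
      by (simp add: continuous_within_eps_delta)
    show "has_delta_derivative T f D t"
      unfolding has_delta_derivative_def h_def[symmetric]
    proof (intro allI impI)
      fix e :: real assume e: "0 < e"
      obtain d where d: "d > 0" "\<forall>s\<in>T. dist s t < d \<longrightarrow> dist (h s) (h t) < e * (m / 2)"
        using lim[rule_format, of "e * (m / 2)"] e m by auto
      show "\<exists>d>0. \<forall>s\<in>{t - d<..<t + d} \<inter> T. norm (h s) \<le> e * \<bar>sigma T t - s\<bar>"
      proof (intro exI[of _ "min d (m / 2)"] conjI ballI)
        show "0 < min d (m / 2)" using d m by simp
        fix s assume s: "s \<in> {t - min d (m / 2)<..<t + min d (m / 2)} \<inter> T"
        then have "dist s t < d" "s \<in> T" by (auto simp: dist_real_def abs_less_iff)
        then have hs: "norm (h s) \<le> e * (m / 2)"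
          using d(2)[rule_format, of s] ht by simp
        have "s < t + m / 2" using s by auto
        then have "m / 2 \<le> sigma T t - s" unfolding m_def by (simp add: field_simps)
        then have "m / 2 \<le> \<bar>sigma T t - s\<bar>" by linarith
        then have "e * (m / 2) \<le> e * \<bar>sigma T t - s\<bar>"
          using e by (intro mult_left_mono) simp_all
        with hs show "norm (h s) \<le> e * \<bar>sigma T t - s\<bar>" by simp
      qed
    qed
  qed
qed

lemma has_delta_derivative_continuous:
  assumes "t \<in> T" "has_delta_derivative T f D t"
  shows "continuous (at t within T) f"
proof (cases "t < sigma T t")
  case True
  then show ?thesis using assms by (simp add: has_delta_derivative_scattered)
next
  case False
  then have "sigma T t = t" using sigma_ge[OF assms(1)] by simp
  then show ?thesis
    using assms(2) by (auto simp: has_delta_derivative_dense intro: has_vector_derivative_continuous)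
qed

lemma has_delta_derivative_subset:
  assumes "has_delta_derivative T f D t" "S \<subseteq> T" "sigma S t = sigma T t"
  shows "has_delta_derivative S f D t"
  unfolding has_delta_derivative_def assms(3)
proof (intro allI impI)
  fix e :: real assume "0 < e"
  then obtain d where "d > 0" "\<forall>s\<in>{t - d<..<t + d} \<inter> T.
      norm (f (sigma T t) - f s - (sigma T t - s) *\<^sub>R D) \<le> e * \<bar>sigma T t - s\<bar>"
    using assms(1) unfolding has_delta_derivative_def by blast
  then show "\<exists>d>0. \<forall>s\<in>{t - d<..<t + d} \<inter> S.
      norm (f (sigma T t) - f s - (sigma T t - s) *\<^sub>R D) \<le> e * \<bar>sigma T t - s\<bar>"
    using assms(2) by (intro exI[of _ d]) auto
qed

lemma has_delta_derivative_cong: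
  assumes "closed T" "t \<in> T" "\<And>s. s \<in> T \<Longrightarrow> f s = g s" "has_delta_derivative T f D t"
  shows "has_delta_derivative T g D t"
  using assms(4) assms(3) sigma_in[OF assms(1,2)] unfolding has_delta_derivative_def by simp

lemma has_delta_derivative_linear:
  fixes f g :: "real \<Rightarrow> complex"
  assumes t: "t \<in> T" and "has_delta_derivative T f D t" "has_delta_derivative T g D' t"
  shows "has_delta_derivative T (\<lambda>s. c * f s + d * g s) (c * D + d * D') t"
proof (cases "t < sigma T t")
  case True
  have cont: "continuous (at t within T) f" "continuous (at t within T) g"
    and jump: "f (sigma T t) - f t = (sigma T t - t) *\<^sub>R D"
      "g (sigma T t) - g t = (sigma T t - t) *\<^sub>R D'"
    using assms True by (auto simp: has_delta_derivative_scattered)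
  have "c * f (sigma T t) + d * g (sigma T t) - (c * f t + d * g t)
      = c * (f (sigma T t) - f t) + d * (g (sigma T t) - g t)"
    by (simp add: algebra_simps)
  also have "\<dots> = (sigma T t - t) *\<^sub>R (c * D + d * D')"
    unfolding jump by (simp add: scaleR_conv_of_real algebra_simps)
  finally show ?thesis
    using t True cont by (auto simp: has_delta_derivative_scattered intro!: continuous_intros)
next
  case False
  then have "sigma T t = t" using sigma_ge[OF t] by simp
  then show ?thesis
    using assms by (auto simp: has_delta_derivative_dense intro!: derivative_intros)
qed

text \<open>
  For a given slope \<open>e\<close>, look at the infimum \<open>m\<close> of the points at which the bound
  \<open>norm (H x - H s) \<le> e * (x - s)\<close> fails. The bound holds at \<open>m\<close>: by continuity if \<open>m\<close> is a limit
  of earlier points, and by the zero derivative at its predecessor otherwise. Then the derivative at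
  \<open>m\<close> keeps the failures away from \<open>m\<close>, either by a gap or by the small slope. The derivative
  is only assumed at points that are not the maximum, since at the maximum of \<open>ts_kappa T\<close> a solution
  of the second order equation is only known to be continuous along \<open>ts_kappa T\<close>.
\<close>

lemma delta_derivative_zero_constant:
  fixes H :: "real \<Rightarrow> 'a::real_normed_vector"
  assumes S: "closed S" "s \<in> S" "t \<in> S" "s \<le> t"
    and cont: "continuous_on S H"
    and D: "\<And>x u. x \<in> S \<Longrightarrow> s \<le> x \<Longrightarrow> u \<in> S \<Longrightarrow> x < u \<Longrightarrow> has_delta_derivative S H 0 x"
  shows "H t = H s"
proof -
  have bound: "norm (H t - H s) \<le> e * (t - s)" if e: "0 < e" for e
  proof (rule ccontr)
    define P where "P x \<longleftrightarrow> norm (H x - H s) \<le> e * (x - s)" for x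
    define B where "B = {x \<in> S. s \<le> x \<and> \<not> P x}"
    define m where "m = Inf B"
    assume "\<not> ?thesis"
    then have tB: "t \<in> B" using S by (auto simp: B_def P_def)
    have bdd: "bdd_below B" by (auto simp: B_def intro!: bdd_belowI[of _ s])
    have "m \<in> closure B" unfolding m_def using tB bdd by (intro closure_contains_Inf) auto
    also have "\<dots> \<subseteq> S" using S(1) by (intro closure_minimal) (auto simp: B_def)
    finally have mS: "m \<in> S" .
    have sm: "s \<le> m" unfolding m_def using tB by (intro cInf_greatest) (auto simp: B_def)
    have mB: "m \<le> x" if "x \<in> B" for x unfolding m_def using bdd that by (intro cInf_lower)
    have before: "P x" if "x \<in> S" "s \<le> x" "x < m" for x
      using mB[of x] that by (force simp: B_def)
    have "P m"
    proof (rule ccontr)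
      assume nP: "\<not> P m"
      then have "s < m" using sm by (cases "s = m") (auto simp: P_def)
      have "continuous (at m within S) (\<lambda>x. norm (H x - H s) - e * (x - s))"
        using cont mS by (auto simp: continuous_on_eq_continuous_within intro!: continuous_intros)
      then obtain d where d: "d > 0" "\<And>x. x \<in> S \<Longrightarrow> dist x m < d \<Longrightarrow>
          dist (norm (H x - H s) - e * (x - s)) (norm (H m - H s) - e * (m - s))
            < norm (H m - H s) - e * (m - s)"
        unfolding continuous_within_eps_delta using nP
        by (meson P_def diff_gt_0_iff_gt not_less)
      have far: "x \<le> m - d" if "x \<in> S" "s \<le> x" "x < m" for x
      proof (rule ccontr)
        assume "\<not> x \<le> m - d"
        then have "\<not> P x" using d(2)[of x] that by (auto simp: dist_real_def P_def)
        then show False using before that by simp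
      qed
      \<comment> \<open>So \<open>m\<close> is left-scattered, and the zero derivative at its predecessor \<open>p\<close> carries
        the bound over the gap.\<close>
      define p where "p = Sup (S \<inter> {s..m - d})"
      have "s \<le> m - d" using far[of s] S \<open>s < m\<close> by simp
      have "p \<in> S \<inter> {s..m - d}" unfolding p_def
        using S \<open>s \<le> m - d\<close> by (intro closed_contains_Sup) (auto intro!: bdd_aboveI[of _ "m - d"])
      then have p: "p \<in> S" "s \<le> p" "p < m" using \<open>d > 0\<close> by auto
      have pm: "x \<le> p" if "x \<in> S" "s \<le> x" "x < m" for x
        unfolding p_def using that far[of x]
        by (intro cSup_upper) (auto intro!: bdd_aboveI[of _ "m - d"])
      have sig: "sigma S p = m"
        unfolding sigma_eq_Inf[OF mS p(3)]
      proof (rule cInf_eq_minimum)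
        show "m \<in> {s \<in> S. p < s}" using mS p by simp
        fix x assume "x \<in> {s \<in> S. p < s}"
        then show "m \<le> x" using pm[of x] p(2) by force
      qed
      have "H m = H p"
        using D[OF p(1,2) mS p(3)] p sig by (simp add: has_delta_derivative_scattered)
      moreover have "P p" using before p by blast
      moreover have "e * (p - s) \<le> e * (m - s)" using e p by simp
      ultimately have "P m" by (simp add: P_def)
      then show False using nP by simp
    qed
    then have mlt: "m < x" if "x \<in> B" for x
      using mB[OF that] that by (cases "x = m") (auto simp: B_def)
    have Dm: "has_delta_derivative S H 0 m" using D[OF mS sm] mlt[OF tB] tB by (auto simp: B_def)
    obtain d where d: "m < d" "\<And>x. x \<in> B \<Longrightarrow> d \<le> x"
    proof (cases "m < sigma S m")
      case True
      moreover have "sigma S m \<le> x" if "x \<in> B" for x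
        using sigma_le mlt[OF that] that by (auto simp: B_def)
      ultimately show ?thesis using that by blast
    next
      case False
      then have "sigma S m = m" using sigma_ge[OF mS] by simp
      then obtain d where d: "d > 0"
        "\<And>x. x \<in> {m - d<..<m + d} \<inter> S \<Longrightarrow> norm (H m - H x) \<le> e * \<bar>m - x\<bar>"
        using Dm e unfolding has_delta_derivative_def by (metis diff_zero scaleR_zero_right)
      have "m + d \<le> x" if "x \<in> B" for x
      proof (rule ccontr)
        assume "\<not> m + d \<le> x"
        then have "norm (H m - H x) \<le> e * (x - m)" using d(1) d(2)[of x] mlt[OF that] that by (auto simp: B_def)
        moreover have "norm (H x - H s) \<le> norm (H m - H x) + norm (H m - H s)"
          using dist_triangle[of "H x" "H s" "H m"] by (simp add: dist_norm norm_minus_commute)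
        moreover have "norm (H m - H s) \<le> e * (m - s)" using \<open>P m\<close> by (simp add: P_def)
        ultimately have "norm (H x - H s) \<le> e * (x - s)" by (simp add: algebra_simps)
        then show False using that by (simp add: B_def P_def)
      qed
      then show ?thesis using that d(1) by force
    qed
    have "d \<le> m" unfolding m_def using tB d(2) by (intro cInf_greatest) auto
    then show False using d(1) by simp
  qed
  have "norm (H t - H s) \<le> 0"
  proof (rule field_le_epsilon)
    fix e :: real assume "0 < e"
    then have "norm (H t - H s) \<le> e / (t - s + 1) * (t - s)" using S by (intro bound) auto
    also have "\<dots> \<le> e" using \<open>0 < e\<close> S by (simp add: field_simps)
    finally show "norm (H t - H s) \<le> 0 + e" by simp
  qed
  then show ?thesis by simp
qed

text \<open>
  Two antiderivatives differ by a constant, which identifies the description in the definition of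
  the integral.
\<close>

lemma delta_integral_eq:
  fixes f :: "real \<Rightarrow> 'a::real_normed_vector"
  assumes T: "closed T" "s \<in> T" "t \<in> T" and F: "delta_antiderivative T f F"
  shows "delta_integral T f s t = F t - F s"
proof -
  have "G t - G s = F t - F s" if G: "delta_antiderivative T f G" for G
  proof -
    have D: "has_delta_derivative T (\<lambda>x. G x - F x) 0 x" if x: "x \<in> ts_kappa T" for x
    proof -
      have xT: "x \<in> T" using x ts_kappa_subset by blast
      have FG: "has_delta_derivative T F (f x) x" "has_delta_derivative T G (f x) x"
        using F G x by (auto simp: delta_antiderivative_def)
      show ?thesis
      proof (cases "x < sigma T x")
        case True
        then have "F (sigma T x) = F x + (sigma T x - x) *\<^sub>R f x"
          "G (sigma T x) = G x + (sigma T x - x) *\<^sub>R f x"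
          using FG xT by (auto simp: has_delta_derivative_scattered algebra_simps)
        then show ?thesis
          using FG True xT by (auto simp: has_delta_derivative_scattered intro!: continuous_intros)
      next
        case False
        then have "sigma T x = x" using sigma_ge[OF xT] by simp
        then show ?thesis using FG has_vector_derivative_diff[of G "f x" "at x within T" F "f x"]
          by (simp add: has_delta_derivative_dense)
      qed
    qed
    have "continuous_on T (\<lambda>x. G x - F x)"
      unfolding continuous_on_eq_continuous_within
    proof
      fix x assume x: "x \<in> T"
      show "continuous (at x within T) (\<lambda>x. G x - F x)"
      proof (cases "x \<in> ts_kappa T")
        case True
        then show ?thesis using D x has_delta_derivative_continuous by blast
      next
        case False
        then have "at x within T = bot" by (rule not_in_ts_kappa_isolated[OF x])
        then show ?thesis by (simp add: continuous_bot)
      qed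
    qed
    note const = delta_derivative_zero_constant[OF T(1) _ _ _ this] 
    have "G t - F t = G s - F s"
    proof (cases "s \<le> t")
      case True
      then show ?thesis using const[of s t] D T later_in_ts_kappa by blast
    next
      case False
      then show ?thesis using const[of t s] D T later_in_ts_kappa by (metis linear)
    qed
    then show ?thesis by (simp add: algebra_simps)
  qed
  then show ?thesis unfolding delta_integral_def using F by (intro the_equality) blast+
qed

section \<open>Antiderivatives of rd-continuous functions\<close>

text \<open>
  A function with one-sided limits everywhere is, near each point \<open>x\<close>, uniformly close to a function
  with one value on each side of \<open>x\<close>. By compactness, in the form of the bisection principle
  \<open>Bolzano\<close>, it is a uniform limit of integrable functions on each interval.
\<close>

lemma regulated_integrable:
  fixes g :: "real \<Rightarrow> 'a::banach"
  assumes left: "\<And>x. \<exists>l. (g \<longlongrightarrow> l) (at_left x)" and right: "\<And>x. \<exists>l. (g \<longlongrightarrow> l) (at_right x)"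
  shows "g integrable_on {a..b}"
proof (cases "a \<le> b")
  case True
  have "\<exists>h. (\<forall>x\<in>{a..b}. norm (g x - h x) \<le> e) \<and> h integrable_on {a..b}" if e: "0 < e" for e
  proof (rule Bolzano[of a b "\<lambda>a b. \<exists>h. (\<forall>x\<in>{a..b}. norm (g x - h x) \<le> e) \<and> h integrable_on {a..b}", OF True])
    fix a b c
    assume "\<exists>h. (\<forall>x\<in>{a..b}. norm (g x - h x) \<le> e) \<and> h integrable_on {a..b}"
      "\<exists>h. (\<forall>x\<in>{b..c}. norm (g x - h x) \<le> e) \<and> h integrable_on {b..c}" and abc: "a \<le> b" "b \<le> c"
    then obtain h k where h: "\<forall>x\<in>{a..b}. norm (g x - h x) \<le> e" "h integrable_on {a..b}"
      and k: "\<forall>x\<in>{b..c}. norm (g x - k x) \<le> e" "k integrable_on {b..c}" by blast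
    let ?j = "\<lambda>x. if x \<le> b then h x else k x"
    have "?j integrable_on {a..b}" using h(2) by (rule integrable_eq) auto
    moreover have "?j integrable_on {b..c}"
      using k(2) by (rule integrable_spike_finite[of "{b}", rotated 2]) auto
    ultimately have "?j integrable_on {a..c}"
      using abc by (rule Henstock_Kurzweil_Integration.integrable_combine[rotated 2])
    moreover have "\<forall>x\<in>{a..c}. norm (g x - ?j x) \<le> e" using h(1) k(1) by auto
    ultimately show "\<exists>h. (\<forall>x\<in>{a..c}. norm (g x - h x) \<le> e) \<and> h integrable_on {a..c}"
      by (intro exI[of _ ?j] conjI)
  next
    fix x
    obtain l r where lr: "(g \<longlongrightarrow> l) (at_left x)" "(g \<longlongrightarrow> r) (at_right x)"
      using left right by blast
    obtain u where u: "u < x" "\<And>y. u < y \<Longrightarrow> y < x \<Longrightarrow> dist (g y) l < e"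
      using tendstoD[OF lr(1) e] eventually_at_left_field by metis
    obtain v where v: "x < v" "\<And>y. x < y \<Longrightarrow> y < v \<Longrightarrow> dist (g y) r < e"
      using tendstoD[OF lr(2) e] eventually_at_right_field by metis
    let ?h = "\<lambda>y. if y < x then l else if y = x then g x else r"
    show "\<exists>d>0. \<forall>a b. a \<le> x \<and> x \<le> b \<and> b - a < d \<longrightarrow>
      (\<exists>h. (\<forall>x\<in>{a..b}. norm (g x - h x) \<le> e) \<and> h integrable_on {a..b})"
    proof (intro exI[of _ "min (x - u) (v - x)"] conjI allI impI)
      show "0 < min (x - u) (v - x)" using u v by simp
      fix a b assume ab: "a \<le> x \<and> x \<le> b \<and> b - a < min (x - u) (v - x)"
      have "\<forall>y\<in>{a..b}. norm (g y - ?h y) \<le> e"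
        using u(2) v(2) ab e by (auto simp: dist_norm intro!: less_imp_le)
      moreover have "?h integrable_on {a..x}"
        by (rule integrable_spike_finite[of "{x}" _ _ "\<lambda>_. l"]) auto
      moreover have "?h integrable_on {x..b}"
        by (rule integrable_spike_finite[of "{x}" _ _ "\<lambda>_. r"]) auto
      ultimately show "\<exists>h. (\<forall>x\<in>{a..b}. norm (g x - h x) \<le> e) \<and> h integrable_on {a..b}"
        using ab Henstock_Kurzweil_Integration.integrable_combine[of a x b ?h]
        by (intro exI[of _ ?h] conjI) auto
    qed
  qed
  then show ?thesis
    using integrable_uniform_limit[of a b g] by simp
qed (simp add: integrable_on_empty)

text \<open>
  The value at \<open>x\<close> is taken from the last point of \<open>T\<close> up to \<open>x\<close>. So a gap \<open>{t..<sigma T t}\<close>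
  carries the value \<open>f t\<close> and contributes \<open>graininess T t * f t\<close> to the integral. Below \<open>T\<close> the
  function has the constant value \<open>f (Sup {})\<close>, which keeps it regulated on the whole line.
\<close>

definition step_extension :: "real set \<Rightarrow> (real \<Rightarrow> 'a) \<Rightarrow> real \<Rightarrow> 'a" where
  "step_extension T f x = f (Sup (T \<inter> {..x}))"

lemma last_point: "Sup (T \<inter> {..x}) \<in> T \<inter> {s..x}" if "closed T" "s \<in> T" "s \<le> x"
  for T :: "real set"
proof -
  have bdd: "bdd_above (T \<inter> {..x})" by (auto intro!: bdd_aboveI[of _ x])
  have "Sup (T \<inter> {..x}) \<in> T \<inter> {..x}" using that bdd by (intro closed_contains_Sup) auto
  moreover have "s \<le> Sup (T \<inter> {..x})" using that bdd by (intro cSup_upper) auto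
  ultimately show ?thesis by auto
qed

text \<open>
  At a point that is not left-dense the limit is taken along the trivial filter and exists vacuously.
\<close>

lemma rd_continuous_left_limit:
  "\<exists>l. (f \<longlongrightarrow> l) (at t within T \<inter> {..<t})" if "rd_continuous T f" "t \<in> T"
proof (cases "at t within T \<inter> {..<t} = bot")
  case False
  then show ?thesis using left_dense_if_limit[OF that(2)] that(1) by (auto simp: rd_continuous_def)
qed simp

text \<open>
  On each side of \<open>x\<close>, either \<open>T\<close> has no points near \<open>x\<close> and the extension is constant there, or
  \<open>x\<close> is a limit of points of \<open>T\<close> from that side and the last point up to \<open>y\<close> tends to \<open>x\<close> with
  \<open>y\<close>. Then the extension has the one-sided limit of \<open>f\<close>.
\<close>

lemma step_extension_at_left:
  assumes T: "closed T" and f: "rd_continuous T f"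
  shows "\<exists>l. (step_extension T f \<longlongrightarrow> l) (at_left x)"
proof (cases "\<exists>u<x. T \<inter> {u<..<x} = {}")
  case True
  then obtain u where u: "u < x" "T \<inter> {u<..<x} = {}" by blast
  have "step_extension T f y = step_extension T f u" if "u < y" "y < x" for y
  proof -
    have "T \<inter> {..y} = T \<inter> {..u}" using u that by force
    then show ?thesis by (simp add: step_extension_def)
  qed
  then have "\<forall>\<^sub>F y in at_left x. step_extension T f y = step_extension T f u"
    using u(1) eventually_at_left_field by blast
  then show ?thesis using tendsto_eventually by blast
next
  case False
  then have app: "\<exists>s\<in>T. u < s \<and> s < x" if "u < x" for u using that by fastforce
  have "x \<in> closure T"
    unfolding closure_approachable
  proof (intro allI impI)
    fix e :: real assume "0 < e"
    then show "\<exists>y\<in>T. dist y x < e" using app[of "x - e"] by (force simp: dist_real_def)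
  qed
  then have xT: "x \<in> T" using T by simp
  obtain l where l: "(f \<longlongrightarrow> l) (at x within T \<inter> {..<x})"
    using rd_continuous_left_limit[OF f xT] by blast
  have ev: "\<forall>\<^sub>F y in at_left x. Sup (T \<inter> {..y}) \<in> T \<and> u < Sup (T \<inter> {..y}) \<and> Sup (T \<inter> {..y}) < x"
    if "u < x" for u
  proof -
    obtain s where s: "s \<in> T" "u < s" "s < x" using app \<open>u < x\<close> by blast
    have "Sup (T \<inter> {..y}) \<in> T \<and> u < Sup (T \<inter> {..y}) \<and> Sup (T \<inter> {..y}) < x" if "s < y" "y < x" for y
      using last_point[OF T s(1), of y] s that by auto
    then show ?thesis unfolding eventually_at_left_field using s by blast
  qed
  have ev1: "\<forall>\<^sub>F y in at_left x. Sup (T \<inter> {..y}) \<in> T \<and> Sup (T \<inter> {..y}) < x"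
    using ev[of "x - 1"] by (auto elim: eventually_mono)
  have "((\<lambda>y. Sup (T \<inter> {..y})) \<longlongrightarrow> x) (at_left x)"
  proof (rule order_tendstoI)
    show "\<forall>\<^sub>F y in at_left x. u < Sup (T \<inter> {..y})" if "u < x" for u
      using ev[OF that] by eventually_elim simp
    show "\<forall>\<^sub>F y in at_left x. Sup (T \<inter> {..y}) < u" if "x < u" for u
      using ev1 by eventually_elim (use that in auto)
  qed
  then have "filterlim (\<lambda>y. Sup (T \<inter> {..y})) (at x within T \<inter> {..<x}) (at_left x)"
    unfolding filterlim_at using eventually_mono[OF ev1] by simp
  then have "((\<lambda>y. f (Sup (T \<inter> {..y}))) \<longlongrightarrow> l) (at_left x)"
    by (rule filterlim_compose[OF l])
  then show ?thesis unfolding step_extension_def[abs_def] by blast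
qed

lemma step_extension_at_right:
  assumes T: "closed T" and f: "rd_continuous T f"
  shows "\<exists>l. (step_extension T f \<longlongrightarrow> l) (at_right x)"
proof (cases "\<exists>u>x. T \<inter> {x<..<u} = {}")
  case True
  then obtain u where u: "x < u" "T \<inter> {x<..<u} = {}" by blast
  have "step_extension T f y = step_extension T f x" if "x < y" "y < u" for y
  proof -
    have "T \<inter> {..y} = T \<inter> {..x}" using u that by force
    then show ?thesis by (simp add: step_extension_def)
  qed
  then have "\<forall>\<^sub>F y in at_right x. step_extension T f y = step_extension T f x"
    using u(1) eventually_at_right_field by blast
  then show ?thesis using tendsto_eventually by blast
next
  case False
  then have app: "\<exists>s\<in>T. x < s \<and> s < u" if "x < u" for u using that by fastforce
  have "x \<in> closure T"
    unfolding closure_approachable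
  proof (intro allI impI)
    fix e :: real assume "0 < e"
    then show "\<exists>y\<in>T. dist y x < e" using app[of "x + e"] by (force simp: dist_real_def)
  qed
  then have xT: "x \<in> T" using T by simp
  have "sigma T x = x"
  proof (rule ccontr)
    assume "sigma T x \<noteq> x"
    then have "x < sigma T x" using sigma_ge[OF xT] by simp
    then obtain s where "s \<in> T" "x < s" "s < sigma T x" using app by blast
    then show False using sigma_le[of s T x] by simp
  qed
  then have "right_dense T x" using xT app[of "x + 1"] by (auto simp: right_dense_def)
  then have cont: "continuous (at x within T) f" using f by (simp add: rd_continuous_def)
  have mem: "Sup (T \<inter> {..y}) \<in> T \<inter> {x..y}" if "x < y" for y
    using last_point[OF T xT, of y] that by simp
  have ev: "\<forall>\<^sub>F y in at_right x. x < y" by (simp add: eventually_at_right_less)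
  have "((\<lambda>y. Sup (T \<inter> {..y})) \<longlongrightarrow> x) (at_right x)"
  proof (rule tendsto_sandwich[of "\<lambda>_. x" _ _ "\<lambda>y. y"])
    show "\<forall>\<^sub>F y in at_right x. x \<le> Sup (T \<inter> {..y})" "\<forall>\<^sub>F y in at_right x. Sup (T \<inter> {..y}) \<le> y"
      using ev by (auto elim!: eventually_mono dest: mem)
  qed auto
  moreover have "\<forall>\<^sub>F y in at_right x. Sup (T \<inter> {..y}) \<in> T"
    using ev by eventually_elim (use mem in auto)
  ultimately have "((\<lambda>y. f (Sup (T \<inter> {..y}))) \<longlongrightarrow> f x) (at_right x)"
    by (intro continuous_within_tendsto_compose[OF cont])
  then show ?thesis unfolding step_extension_def[abs_def] by blast
qed

text \<open>
  This mean value estimate is the only property of the integral that is used afterwards. With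
  \<open>\<epsilon> = 0\<close> and \<open>L = f s\<close> it gives the exact increment over a gap from \<open>s\<close>, and for \<open>L\<close> a one-sided
  limit of \<open>f\<close> it gives the one-sided derivative, even where \<open>f\<close> itself takes another value.
\<close>

definition mean_value_primitive ::
  "real set \<Rightarrow> (real \<Rightarrow> 'a::real_normed_vector) \<Rightarrow> (real \<Rightarrow> 'a) \<Rightarrow> bool" where
  "mean_value_primitive T f F \<longleftrightarrow>
    (\<forall>s\<in>T. \<forall>t\<in>T. \<forall>L \<epsilon>. s \<le> t \<longrightarrow> 0 \<le> \<epsilon> \<longrightarrow> (\<forall>u\<in>T \<inter> {s..<t}. norm (f u - L) \<le> \<epsilon>) \<longrightarrow>
      norm (F t - F s - (t - s) *\<^sub>R L) \<le> \<epsilon> * (t - s))"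

lemma mean_value_primitive_exists:
  fixes f :: "real \<Rightarrow> 'a::banach"
  assumes T: "closed T" and f: "rd_continuous T f"
  shows "\<exists>F. mean_value_primitive T f F"
proof -
  let ?g = "step_extension T f"
  \<comment> \<open>An oriented integral from 0: one of the two intervals is empty or a point.\<close>
  define F where "F t = integral {0..t} ?g - integral {t..0} ?g" for t
  have int: "?g integrable_on {a..b}" for a b
    using step_extension_at_left[OF assms] step_extension_at_right[OF assms]
    by (intro regulated_integrable)
  note combine = Henstock_Kurzweil_Integration.integral_combine[OF _ _ int]
  have F: "F t - F s = integral {s..t} ?g" if "s \<le> t" for s t
  proof -
    consider "0 \<le> s" | "s < 0" "0 \<le> t" | "t < 0" using that by linarith
    then show ?thesis
    proof cases
      case 1
      then show ?thesis using combine[of 0 s t] that by (cases "s = 0"; cases "t = 0") (auto simp: F_def algebra_simps)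
    next
      case 2
      then show ?thesis using combine[of s 0 t] that by (cases "t = 0") (auto simp: F_def algebra_simps)
    next
      case 3
      then show ?thesis using combine[of s t 0] that by (auto simp: F_def algebra_simps)
    qed
  qed
  show ?thesis
    unfolding mean_value_primitive_def
  proof (intro exI[of _ F] ballI allI impI)
    fix s t e :: real and L :: 'a
    assume st: "s \<in> T" "t \<in> T" "s \<le> t" "0 \<le> e" and L: "\<forall>u\<in>T \<inter> {s..<t}. norm (f u - L) \<le> e"
    have "((\<lambda>x. ?g x - L) has_integral (F t - F s - (t - s) *\<^sub>R L)) (cbox s t)"
      unfolding F[OF st(3)] using has_integral_const_real[of L s t] st(3)
      by (intro has_integral_diff) (auto simp: integrable_integral int)
    moreover have "norm (?g x - L) \<le> e" if "x \<in> cbox s t - {t}" for x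
    proof -
      have "s \<le> x" "x < t" using that by auto
      then have "Sup (T \<inter> {..x}) \<in> T \<inter> {s..<t}" using last_point[OF T st(1), of x] by auto
      then show ?thesis using L by (simp add: step_extension_def)
    qed
    ultimately have "norm (F t - F s - (t - s) *\<^sub>R L) \<le> e * measure lborel (cbox s t)"
      using st(4) by (intro has_integral_bound_spike_finite[of e "{t}"]) auto
    then show "norm (F t - F s - (t - s) *\<^sub>R L) \<le> e * (t - s)" using st(3) by simp
  qed
qed

text \<open>
  The hypothesis on the right side has two forms because of the left-dense maximum of \<open>ts_kappa T\<close>:
  if \<open>S\<close> does not go beyond \<open>t\<close>, only the left limit \<open>L\<close> matters and it may differ from \<open>f t\<close>.
\<close>

lemma mean_value_primitive_deriv:
  assumes F: "mean_value_primitive T f F" and t: "t \<in> T"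
    and left: "(f \<longlongrightarrow> L) (at t within T \<inter> {..<t})"
    and S: "S \<subseteq> T"
    and right: "S \<subseteq> {..t} \<or> L = f t \<and> (f \<longlongrightarrow> f t) (at t within T \<inter> {t<..})"
  shows "(F has_vector_derivative L) (at t within S)"
  unfolding has_vector_derivative_def has_derivative_within_alt
proof (intro conjI allI impI)
  fix e :: real assume e: "0 < e"
  obtain d where d: "d > 0" "\<And>u. u \<in> T \<Longrightarrow> u < t \<Longrightarrow> t - u < d \<Longrightarrow> norm (f u - L) \<le> e"
    using tendstoD[OF left e] unfolding eventually_at
    by (force simp: dist_real_def dist_norm)
  obtain d' where d': "d' > 0"
    "\<And>u s. u \<in> T \<Longrightarrow> s \<in> S \<Longrightarrow> t \<le> u \<Longrightarrow> u < s \<Longrightarrow> u - t < d' \<Longrightarrow> norm (f u - L) \<le> e"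
  proof (cases "S \<subseteq> {..t}")
    case True
    then show ?thesis using that[of 1] by force
  next
    case False
    then have r: "L = f t" "(f \<longlongrightarrow> f t) (at t within T \<inter> {t<..})" using right by auto
    obtain d where "d > 0" "\<And>u. u \<in> T \<Longrightarrow> t < u \<Longrightarrow> u - t < d \<Longrightarrow> norm (f u - f t) \<le> e"
      using tendstoD[OF r(2) e] unfolding eventually_at
      by (force simp: dist_real_def dist_norm)
    then have "norm (f u - L) \<le> e" if "u \<in> T" "t \<le> u" "u - t < d" for u
      using that e r(1) by (cases "u = t") auto
    then show ?thesis using that \<open>d > 0\<close> by blast
  qed
  have "norm (F y - F t - (y - t) *\<^sub>R L) \<le> e * norm (y - t)"
    if y: "y \<in> S" "norm (y - t) < min d d'" for y
  proof (cases "t \<le> y")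
    case True
    then have "norm (F y - F t - (y - t) *\<^sub>R L) \<le> e * (y - t)"
      using F[unfolded mean_value_primitive_def, rule_format, of t y e L] t y e S d'(2)[of _ y]
      by auto
    then show ?thesis using True by simp
  next
    case False
    then have "norm (F t - F y - (t - y) *\<^sub>R L) \<le> e * (t - y)"
      using F[unfolded mean_value_primitive_def, rule_format, of y t e L] t y e S d(2) by auto
    moreover have "F t - F y - (t - y) *\<^sub>R L = - (F y - F t - (y - t) *\<^sub>R L)"
      by (simp add: algebra_simps)
    ultimately have "norm (F y - F t - (y - t) *\<^sub>R L) \<le> e * (t - y)"
      by (metis norm_minus_cancel)
    then show ?thesis using False by simp
  qed
  then show "\<exists>d>0. \<forall>y\<in>S. norm (y - t) < d \<longrightarrow>
      norm (F y - F t - (y - t) *\<^sub>R L) \<le> e * norm (y - t)"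
    using d(1) d'(1) by (intro exI[of _ "min d d'"]) auto
qed (simp add: bounded_linear_scaleR_left)

text \<open>
  Besides right-dense points, \<open>sigma T t = t\<close> holds at the maximum of \<open>T\<close>, where rd-continuity says
  nothing about the value of \<open>f\<close>. If the maximum is left-dense, the derivative of \<open>F\<close> there is the
  left limit of \<open>f\<close>, hence the additional assumption.
\<close>

lemma mean_value_primitive_antiderivative:
  assumes T: "closed T" and f: "rd_continuous T f" and F: "mean_value_primitive T f F"
    and end_cont: "\<And>m. is_maximum T m \<Longrightarrow> left_dense T m \<Longrightarrow> continuous (at m within T) f"
  shows "delta_antiderivative T f F"
  unfolding delta_antiderivative_def
proof
  fix t assume "t \<in> ts_kappa T"
  then have t: "t \<in> T" using ts_kappa_subset by blast
  show "has_delta_derivative T F (f t) t"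
  proof (cases "t < sigma T t")
    case True
    obtain l where "(f \<longlongrightarrow> l) (at t within T \<inter> {..<t})"
      using rd_continuous_left_limit[OF f t] by blast
    then have "(F has_vector_derivative l) (at t within T \<inter> {..t})"
      by (rule mean_value_primitive_deriv[OF F t]) auto
    then have "continuous (at t within T \<inter> {..t}) F" by (rule has_vector_derivative_continuous)
    moreover have "at t within T \<inter> {..t} = at t within T"
      by (rule at_within_nhd[of _ "{..<sigma T t}"]) (use True sigma_le[of _ T t] in force)+
    moreover have "norm (F (sigma T t) - F t - (sigma T t - t) *\<^sub>R f t) \<le> 0 * (sigma T t - t)"
    proof (rule F[unfolded mean_value_primitive_def, rule_format])
      fix u assume "u \<in> T \<inter> {t..<sigma T t}"
      then have "u = t" using sigma_le[of u T t] by force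
      then show "norm (f u - f t) \<le> 0" by simp
    qed (use t True sigma_in[OF T t] in auto)
    ultimately show ?thesis using t True by (simp add: has_delta_derivative_scattered)
  next
    case False
    then have sig: "sigma T t = t" using sigma_ge[OF t] by simp
    have "continuous (at t within T) f"
    proof (cases "\<exists>u\<in>T. t < u")
      case True
      then show ?thesis using f t sig by (simp add: rd_continuous_def right_dense_def)
    next
      case False
      then have mx: "is_maximum T t" using t by (auto simp: is_maximum_def not_less)
      show ?thesis
        using at_within_maximum[OF mx] left_dense_if_limit[OF t] end_cont[OF mx] continuous_bot
        by metis
    qed
    then have "(f \<longlongrightarrow> f t) (at t within T)" by (simp add: continuous_within)
    then have "(F has_vector_derivative f t) (at t within T)"
      by (intro mean_value_primitive_deriv[OF F t]) (auto intro: tendsto_within_subset)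
    then show ?thesis by (simp add: has_delta_derivative_dense sig)
  qed
qed

section \<open>The exponential function\<close>

text \<open>
  The cylinder transform is \<open>z * \<phi> (h * z)\<close> with \<open>\<phi> w = Ln (1 + w) / w\<close>, and \<open>\<phi>\<close> extends
  continuously by 1 at 0, the derivative of the logarithm at 1.
\<close>

lemma tendsto_cylinder:
  assumes q: "(q \<longlongrightarrow> z) G" and h: "(h \<longlongrightarrow> 0) G"
  shows "((\<lambda>x. cylinder (h x) (q x)) \<longlongrightarrow> z) G"
proof -
  define \<phi> :: "complex \<Rightarrow> complex" where "\<phi> w = (if w = 0 then 1 else Ln (1 + w) / w)" for w
  have eq: "cylinder x w = w * \<phi> (of_real x * w)" for x w
    by (simp add: cylinder_def \<phi>_def)
  have "((\<lambda>w. Ln (1 + w)) has_field_derivative 1) (at 0)"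
    by (auto intro!: derivative_eq_intros)
  then have "(\<lambda>w. Ln (1 + w) / w) \<midarrow>0\<rightarrow> 1"
    by (simp add: has_field_derivative_iff)
  then have "\<phi> \<midarrow>0\<rightarrow> 1"
    by (rule Lim_transform_eventually) (auto simp: \<phi>_def eventually_at_filter)
  then have "isCont \<phi> 0" by (simp add: isCont_def \<phi>_def)
  moreover have "((\<lambda>x. of_real (h x) * q x) \<longlongrightarrow> 0) G"
    using tendsto_mult[OF tendsto_of_real[OF h] q] by simp
  ultimately have "((\<lambda>x. \<phi> (of_real (h x) * q x)) \<longlongrightarrow> \<phi> 0) G"
    by (rule isCont_tendsto_compose)
  from tendsto_mult[OF q this] show ?thesis by (simp add: eq \<phi>_def)
qed

text \<open>
  A point \<open>s < t\<close> jumps at most to \<open>t\<close>, so \<open>graininess T s \<le> t - s\<close>. To the right of a right-dense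
  \<open>t\<close>, points close to \<open>t\<close> jump at most to some fixed \<open>u\<close> close to \<open>t\<close>.
\<close>

lemma graininess_tendsto_left: "(graininess T \<longlongrightarrow> 0) (at t within T \<inter> {..<t})" if t: "t \<in> T"
proof (rule tendsto_sandwich[of "\<lambda>_. 0" _ _ "\<lambda>s. t - s"])
  have "\<forall>\<^sub>F s in at t within T \<inter> {..<t}. s \<in> T \<inter> {..<t}" by (simp add: eventually_at_filter)
  then show "\<forall>\<^sub>F s in at t within T \<inter> {..<t}. 0 \<le> graininess T s"
    "\<forall>\<^sub>F s in at t within T \<inter> {..<t}. graininess T s \<le> t - s"
    using sigma_le[OF t] by (auto elim!: eventually_mono simp: graininess_nonneg)
      (simp add: graininess_def)
  have "((\<lambda>s. t - s) \<longlongrightarrow> t - t) (at t within T \<inter> {..<t})" by (intro tendsto_intros)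
  then show "((\<lambda>s. t - s) \<longlongrightarrow> 0) (at t within T \<inter> {..<t})" by simp
qed simp

lemma graininess_tendsto_right_dense: "(graininess T \<longlongrightarrow> 0) (at t within T)" if rd: "right_dense T t"
proof (rule tendstoI)
  fix e :: real assume "0 < e"
  then obtain u where u: "u \<in> T" "t < u" "u < t + e" using right_dense_approach[OF rd] by blast
  have t: "t \<in> T" using rd by (simp add: right_dense_def)
  have "dist (graininess T s) 0 < e" if s: "s \<in> T" "dist s t < u - t" for s
  proof -
    have "graininess T s < e"
      using sigma_le[OF t, of s] sigma_le[OF u(1), of s] u s
      by (cases "s < t") (auto simp: graininess_def dist_real_def)
    then show ?thesis using graininess_nonneg[OF s(1)] by simp
  qed
  then show "\<forall>\<^sub>F s in at t within T. dist (graininess T s) 0 < e"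
    unfolding eventually_at using u by (intro exI[of _ "u - t"]) auto
qed

text \<open>
  Only right-dense and left-dense points matter, and near them the graininess tends to 0. So the
  branch cut of the logarithm, which can make the transform irregular at scattered points, is avoided.
\<close>

lemma rd_continuous_cylinder:
  assumes "rd_continuous T q"
  shows "rd_continuous T (\<lambda>t. cylinder (graininess T t) (q t))"
  unfolding rd_continuous_def
proof (intro conjI allI impI)
  fix t assume rd: "right_dense T t"
  then have "graininess T t = 0" by (simp add: right_dense_def graininess_def)
  moreover have "(q \<longlongrightarrow> q t) (at t within T)"
    using assms rd by (simp add: rd_continuous_def continuous_within)
  ultimately show "continuous (at t within T) (\<lambda>t. cylinder (graininess T t) (q t))"
    using tendsto_cylinder[OF _ graininess_tendsto_right_dense[OF rd]]
    by (simp add: continuous_within cylinder_def[of 0])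
next
  fix t assume ld: "left_dense T t"
  then have t: "t \<in> T" by (simp add: left_dense_def)
  then show "\<exists>l. ((\<lambda>t. cylinder (graininess T t) (q t)) \<longlongrightarrow> l) (at t within T \<inter> {..<t})"
    using rd_continuous_left_limit[OF assms] tendsto_cylinder[OF _ graininess_tendsto_left] by blast
qed

text \<open>
  The derivative of the exponential is needed on \<open>T\<close> and on \<open>ts_kappa T\<close>. The two differ only at the
  maximum \<open>m\<close> of \<open>ts_kappa T\<close>, when \<open>m\<close> is right-scattered in \<open>T\<close>: on \<open>T\<close> the derivative is a jump
  to the removed maximum, on \<open>ts_kappa T\<close> it is a derivative from the left. In the second case the
  cylinder transform at \<open>m\<close> is a logarithm different from \<open>q m\<close>, but its left limit is \<open>q m\<close>.
\<close>

lemma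
  fixes q :: "real \<Rightarrow> complex"
  assumes T: "closed T" and t0: "t0 \<in> T" and q: "rd_continuous T q"
    and q_end: "continuous_at_left_dense_end T q"
    and regr: "\<And>t. t \<in> ts_kappa T \<Longrightarrow> 1 + of_real (graininess T t) * q t \<noteq> 0"
  shows ts_exp_delta_derivative: "t \<in> ts_kappa T \<Longrightarrow>
      has_delta_derivative T (\<lambda>t. ts_exp T q t t0) (q t * ts_exp T q t t0) t"
    and ts_exp_delta_derivative_kappa: "t \<in> ts_kappa T \<Longrightarrow>
      has_delta_derivative (ts_kappa T) (\<lambda>t. ts_exp T q t t0) (q t * ts_exp T q t t0) t"
    and ts_exp_self: "ts_exp T q t0 t0 = 1"
proof -
  define f where "f t = cylinder (graininess T t) (q t)" for t
  have f: "rd_continuous T f" unfolding f_def[abs_def] by (rule rd_continuous_cylinder[OF q])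
  obtain F where F: "mean_value_primitive T f F"
    using mean_value_primitive_exists[OF T f] by blast
  have f_left: "(f \<longlongrightarrow> q m) (at m within T \<inter> {..<m})"
    if "is_maximum (ts_kappa T) m" "left_dense T m" for m
  proof -
    have "(q \<longlongrightarrow> q m) (at m within T)"
      using q_end that by (simp add: continuous_at_left_dense_end_def continuous_within)
    then have "(q \<longlongrightarrow> q m) (at m within T \<inter> {..<m})" by (rule tendsto_within_subset) simp
    then show ?thesis unfolding f_def[abs_def]
      using that(2) by (intro tendsto_cylinder graininess_tendsto_left) (auto simp: left_dense_def)
  qed
  have anti: "delta_antiderivative T f F"
  proof (rule mean_value_primitive_antiderivative[OF T f F])
    fix m assume m: "is_maximum T m" "left_dense T m"
    then have "m \<in> ts_kappa T" by (auto simp: ts_kappa_def left_scattered_def left_dense_def)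
    then have "is_maximum (ts_kappa T) m" using m ts_kappa_subset by (auto simp: is_maximum_def)
    from f_left[OF this m(2)] have "(f \<longlongrightarrow> q m) (at m within T)"
      using at_within_maximum[OF m(1)] by simp
    moreover have "sigma T m = m" using m by (intro sigma_eq_self) (auto simp: is_maximum_def)
    then have "f m = q m" by (simp add: f_def graininess_def cylinder_def)
    ultimately show "continuous (at m within T) f" by (simp add: continuous_within)
  qed
  define E where "E t = exp (F t - F t0)" for t
  have ts_exp_E: "ts_exp T q t t0 = E t" if "t \<in> T" for t
    using delta_integral_eq[OF T t0 that anti] by (simp add: ts_exp_def E_def f_def[abs_def])
  show "ts_exp T q t0 t0 = 1" using ts_exp_E[OF t0] by (simp add: E_def)
  have E_dense: "(E has_vector_derivative D * E t) (at t within S)"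
    if "(F has_vector_derivative D) (at t within S)" for t D S
  proof -
    have "((\<lambda>s. F s - F t0) has_vector_derivative D) (at t within S)"
      using that by (auto intro!: derivative_eq_intros)
    from field_vector_diff_chain_within[OF this DERIV_subset[OF DERIV_exp]]
    show ?thesis by (simp add: o_def E_def[abs_def])
  qed
  have E_deriv: "has_delta_derivative T E (q t * E t) t" if tk: "t \<in> ts_kappa T" for t
  proof -
    have t: "t \<in> T" using tk ts_kappa_subset by blast
    have D: "has_delta_derivative T F (f t) t" using anti tk by (simp add: delta_antiderivative_def)
    show ?thesis
    proof (cases "t < sigma T t")
      case True
      define m where "m = sigma T t - t"
      have m: "0 < m" "graininess T t = m" using True by (auto simp: m_def graininess_def)
      have c: "continuous (at t within T) F" and j: "F (sigma T t) - F t = m *\<^sub>R f t"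
        using D t True by (auto simp: has_delta_derivative_scattered m_def)
      have "m *\<^sub>R f t = Ln (1 + of_real m * q t)"
        using m by (simp add: f_def cylinder_def scaleR_conv_of_real)
      then have "E (sigma T t) = E t * exp (Ln (1 + of_real m * q t))"
        using j by (simp add: E_def exp_add[symmetric] algebra_simps)
      then have "E (sigma T t) = E t * (1 + of_real m * q t)"
        using regr[OF tk] m by simp
      then have "E (sigma T t) - E t = m *\<^sub>R (q t * E t)"
        by (simp add: scaleR_conv_of_real algebra_simps)
      moreover have "continuous (at t within T) E"
        unfolding E_def[abs_def] using c by (intro continuous_intros)
      ultimately show ?thesis using t True by (simp add: has_delta_derivative_scattered m_def)
    next
      case False
      then have sig: "sigma T t = t" using sigma_ge[OF t] by simp
      then have "f t = q t" by (simp add: f_def graininess_def cylinder_def)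
      then show ?thesis using D E_dense by (simp add: has_delta_derivative_dense sig)
    qed
  qed
  show "has_delta_derivative T (\<lambda>t. ts_exp T q t t0) (q t * ts_exp T q t t0) t"
    if tk: "t \<in> ts_kappa T"
  proof (rule has_delta_derivative_cong[OF T, of _ E])
    show t: "t \<in> T" using tk ts_kappa_subset by blast
    then show "has_delta_derivative T E (q t * ts_exp T q t t0) t"
      using E_deriv[OF tk] by (simp add: ts_exp_E)
  qed (simp add: ts_exp_E)
  show "has_delta_derivative (ts_kappa T) (\<lambda>t. ts_exp T q t t0) (q t * ts_exp T q t t0) t"
    if tk: "t \<in> ts_kappa T"
  proof (rule has_delta_derivative_cong[OF closed_ts_kappa[OF T] tk, of E])
    show "E s = ts_exp T q s t0" if "s \<in> ts_kappa T" for s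
      using that ts_kappa_subset ts_exp_E by fastforce
    have t: "t \<in> T" using tk ts_kappa_subset by blast
    have "has_delta_derivative (ts_kappa T) E (q t * E t) t"
    proof (cases "\<exists>u\<in>ts_kappa T. t < u")
      case True
      then show ?thesis
        using has_delta_derivative_subset[OF E_deriv[OF tk] ts_kappa_subset] sigma_ts_kappa by blast
    next
      case False
      then have mx: "is_maximum (ts_kappa T) t" using tk by (auto simp: is_maximum_def not_less)
      then have sig: "sigma (ts_kappa T) t = t"
        by (intro sigma_eq_self) (auto simp: is_maximum_def)
      have "(F has_vector_derivative q t) (at t within ts_kappa T)"
      proof (cases "at t within ts_kappa T = bot")
        case True
        then show ?thesis
          by (simp add: has_vector_derivative_def has_derivative_def bounded_linear_scaleR_left)
      next
        case False
        have "at t within ts_kappa T = at t within (ts_kappa T \<inter> {..<t})"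
          by (rule at_within_maximum[OF mx])
        also have "\<dots> \<le> at t within (T \<inter> {..<t})"
          using ts_kappa_subset[of T] by (intro at_le) auto
        finally have "at t within (T \<inter> {..<t}) \<noteq> bot" using False bot.extremum_unique by metis
        then have "left_dense T t" using left_dense_if_limit[OF t] by simp
        from mean_value_primitive_deriv[OF F t f_left[OF mx this] ts_kappa_subset]
        show ?thesis using mx by (auto simp: is_maximum_def)
      qed
      then show ?thesis using E_dense by (simp add: has_delta_derivative_dense sig)
    qed
    then show "has_delta_derivative (ts_kappa T) E (q t * ts_exp T q t t0) t"
      by (simp add: ts_exp_E t)
  qed
qed

section \<open>The second order equation\<close>

lemma has_alpha_derivative_linear:
  assumes "t \<in> T" "has_alpha_derivative T \<kappa>0 \<kappa>1 \<alpha> f D t" "has_alpha_derivative T \<kappa>0 \<kappa>1 \<alpha> g D' t"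
  shows "has_alpha_derivative T \<kappa>0 \<kappa>1 \<alpha> (\<lambda>s. c * f s + d * g s) (c * D + d * D') t"
proof -
  obtain e e' where "has_delta_derivative T f e t" "D = of_real (\<kappa>1 \<alpha> t) * f t + of_real (\<kappa>0 \<alpha> t) * e"
    "has_delta_derivative T g e' t" "D' = of_real (\<kappa>1 \<alpha> t) * g t + of_real (\<kappa>0 \<alpha> t) * e'"
    using assms unfolding has_alpha_derivative_def by blast
  with has_delta_derivative_linear[OF assms(1), of f e g e' c d] show ?thesis
    unfolding has_alpha_derivative_def
    by (intro exI[of _ "c * e + d * e'"]) (simp add: algebra_simps)
qed

lemma solves_equation_linear:
  assumes "solves_equation T \<kappa>0 \<kappa>1 \<alpha> a b t0 y v" "solves_equation T \<kappa>0 \<kappa>1 \<alpha> a b t0 z w"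
  shows "solves_equation T \<kappa>0 \<kappa>1 \<alpha> a b t0 (\<lambda>t. c * y t + d * z t) (\<lambda>t. c * v t + d * w t)"
  unfolding solves_equation_def
proof (intro conjI ballI)
  fix t assume t: "t \<in> ts_kappa T \<inter> {t0..}"
  then show "has_alpha_derivative (T \<inter> {t0..}) \<kappa>0 \<kappa>1 \<alpha> (\<lambda>t. c * y t + d * z t) (c * v t + d * w t) t"
    using assms ts_kappa_subset[of T] unfolding solves_equation_def
    by (intro has_alpha_derivative_linear) auto
next
  fix t assume t: "t \<in> ts_kappa (ts_kappa T) \<inter> {t0..}"
  obtain p q where
    "has_alpha_derivative (ts_kappa T \<inter> {t0..}) \<kappa>0 \<kappa>1 \<alpha> v p t" "p + of_real a * v t + of_real b * y t = 0"
    "has_alpha_derivative (ts_kappa T \<inter> {t0..}) \<kappa>0 \<kappa>1 \<alpha> w q t" "q + of_real a * w t + of_real b * z t = 0"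
    using assms t unfolding solves_equation_def by blast
  note pq = this
  have "has_alpha_derivative (ts_kappa T \<inter> {t0..}) \<kappa>0 \<kappa>1 \<alpha> (\<lambda>t. c * v t + d * w t) (c * p + d * q) t"
    using t pq ts_kappa_subset[of "ts_kappa T"] by (intro has_alpha_derivative_linear) auto
  moreover have "c * p + d * q + of_real a * (c * v t + d * w t) + of_real b * (c * y t + d * z t)
    = c * (p + of_real a * v t + of_real b * y t) + d * (q + of_real a * w t + of_real b * z t)"
    by (simp add: algebra_simps)
  ultimately show "\<exists>r. has_alpha_derivative (ts_kappa T \<inter> {t0..}) \<kappa>0 \<kappa>1 \<alpha> (\<lambda>t. c * v t + d * w t) r t \<and>
      r + of_real a * (c * v t + d * w t) + of_real b * (c * y t + d * z t) = 0"
    using pq by auto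
qed

text \<open>
  The equation \<open>E\<^sup>\<Delta> = q E\<close> says that \<open>E\<close> is an eigenfunction of \<open>\<Delta>\<^sup>\<alpha>\<close> with eigenvalue \<open>lam\<close>.
  Passing to the half line from \<open>t0\<close> does not change forward jumps.
\<close>

lemma characteristic_root_solves:
  fixes E :: "real \<Rightarrow> complex"
  assumes \<kappa>0: "\<And>t. t \<in> T \<Longrightarrow> \<kappa>0 \<alpha> t \<noteq> 0"
    and E: "\<And>t. t \<in> ts_kappa T \<Longrightarrow> has_delta_derivative T E (exp_quotient \<kappa>0 \<kappa>1 \<alpha> lam t * E t) t"
    and E_kappa: "\<And>t. t \<in> ts_kappa T \<Longrightarrow>
      has_delta_derivative (ts_kappa T) E (exp_quotient \<kappa>0 \<kappa>1 \<alpha> lam t * E t) t"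
    and lam: "lam\<^sup>2 + of_real a * lam + of_real b = 0"
  shows "solves_equation T \<kappa>0 \<kappa>1 \<alpha> a b t0 E (\<lambda>t. lam * E t)"
proof -
  let ?q = "exp_quotient \<kappa>0 \<kappa>1 \<alpha> lam"
  have eigen: "lam * E t = of_real (\<kappa>1 \<alpha> t) * E t + of_real (\<kappa>0 \<alpha> t) * (?q t * E t)"
    if "t \<in> T" for t
    using \<kappa>0[OF that] by (simp add: exp_quotient_def field_simps)
  show ?thesis
    unfolding solves_equation_def
  proof (intro conjI ballI)
    fix t assume t: "t \<in> ts_kappa T \<inter> {t0..}"
    then have tT: "t \<in> T" using ts_kappa_subset by blast
    have "has_delta_derivative (T \<inter> {t0..}) E (?q t * E t) t"
      using t tT sigma_half_line by (intro has_delta_derivative_subset[OF E]) auto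
    then show "has_alpha_derivative (T \<inter> {t0..}) \<kappa>0 \<kappa>1 \<alpha> E (lam * E t) t"
      unfolding has_alpha_derivative_def using eigen[OF tT] by blast
  next
    fix t assume "t \<in> ts_kappa (ts_kappa T) \<inter> {t0..}"
    then have t: "t \<in> ts_kappa T" "t0 \<le> t" using ts_kappa_subset by auto
    then have tT: "t \<in> T" using ts_kappa_subset by blast
    have "has_delta_derivative (ts_kappa T \<inter> {t0..}) E (?q t * E t) t"
      using t sigma_half_line by (intro has_delta_derivative_subset[OF E_kappa]) auto
    then have "has_alpha_derivative (ts_kappa T \<inter> {t0..}) \<kappa>0 \<kappa>1 \<alpha> E (lam * E t) t"
      unfolding has_alpha_derivative_def using eigen[OF tT] by blast
    from has_alpha_derivative_linear[OF _ this this, of lam 0]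
    have "has_alpha_derivative (ts_kappa T \<inter> {t0..}) \<kappa>0 \<kappa>1 \<alpha> (\<lambda>t. lam * E t) (lam * (lam * E t)) t"
      using t by simp
    moreover have "lam * (lam * E t) + of_real a * (lam * E t) + of_real b * E t
        = (lam\<^sup>2 + of_real a * lam + of_real b) * E t"
      by (simp add: algebra_simps power2_eq_square)
    ultimately show "\<exists>w. has_alpha_derivative (ts_kappa T \<inter> {t0..}) \<kappa>0 \<kappa>1 \<alpha> (\<lambda>t. lam * E t) w t \<and>
        w + of_real a * (lam * E t) + of_real b * E t = 0"
      using lam by auto
  qed
qed

text \<open>
  The quotient has delta derivative zero: by the quotient rule if \<open>sigma S x = x\<close>, and because both
  functions are multiplied by the same factor \<open>1 + \<mu> q\<close> over a gap. This factor is nonzero since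
  \<open>E\<close> has no zeros.
\<close>

lemma first_order_ratio_constant:
  fixes u E :: "real \<Rightarrow> complex"
  assumes S: "closed S" "s \<in> S" "t \<in> S" "s \<le> t"
    and cont: "continuous_on S u" "continuous_on S E"
    and nz: "\<And>x. E x \<noteq> 0"
    and u: "\<And>x z. x \<in> S \<Longrightarrow> s \<le> x \<Longrightarrow> z \<in> S \<Longrightarrow> x < z \<Longrightarrow> has_delta_derivative S u (q x * u x) x"
    and E: "\<And>x z. x \<in> S \<Longrightarrow> s \<le> x \<Longrightarrow> z \<in> S \<Longrightarrow> x < z \<Longrightarrow> has_delta_derivative S E (q x * E x) x"
  shows "u t / E t = u s / E s"
proof (rule delta_derivative_zero_constant[OF S, of "\<lambda>x. u x / E x"])
  show "continuous_on S (\<lambda>x. u x / E x)" using cont nz by (intro continuous_intros) auto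
  fix x z assume x: "x \<in> S" "s \<le> x" "z \<in> S" "x < z"
  note Du = u[OF x] and DE = E[OF x]
  show "has_delta_derivative S (\<lambda>x. u x / E x) 0 x"
  proof (cases "x < sigma S x")
    case True
    let ?m = "of_real (sigma S x - x) :: complex"
    have "u (sigma S x) - u x = ?m * (q x * u x)" "E (sigma S x) - E x = ?m * (q x * E x)"
      and c: "continuous (at x within S) u" "continuous (at x within S) E"
      using Du DE x(1) True by (auto simp: has_delta_derivative_scattered scaleR_conv_of_real)
    then have "u (sigma S x) = (1 + ?m * q x) * u x" "E (sigma S x) = (1 + ?m * q x) * E x"
      by (auto simp: algebra_simps)
    then have "u (sigma S x) / E (sigma S x) = u x / E x"
      using nz[of "sigma S x"] by auto
    then show ?thesis
      using c nz x(1) True by (auto simp: has_delta_derivative_scattered intro!: continuous_intros)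
  next
    case False
    then have sig: "sigma S x = x" using sigma_ge[OF x(1)] by simp
    have *: "((\<lambda>y. inverse (E y)) has_vector_derivative (q x * E x) * (- inverse (E x) * inverse (E x)))
        (at x within S)"
      using field_vector_diff_chain_within[OF DE[unfolded has_delta_derivative_dense[OF sig]]
          DERIV_inverse[OF nz[of x]]]
      by (simp add: o_def)
    have "((\<lambda>y. u y * inverse (E y)) has_vector_derivative
        u x * ((q x * E x) * (- inverse (E x) * inverse (E x))) + q x * u x * inverse (E x)) (at x within S)"
      using Du by (intro has_vector_derivative_mult *) (simp add: has_delta_derivative_dense sig)
    moreover have "u x * ((q x * E x) * (- inverse (E x) * inverse (E x))) + q x * u x * inverse (E x) = 0"
      using nz[of x] by (simp add: field_simps)
    ultimately have "((\<lambda>y. u y * inverse (E y)) has_vector_derivative 0) (at x within S)" by metis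
    then show ?thesis by (simp add: has_delta_derivative_dense sig divide_inverse)
  qed
qed

text \<open>
  The factorization of the equation: \<open>v - lam y\<close> satisfies the first order equation of the other
  root \<open>lam'\<close>, as does \<open>E\<close>. The functions are compared on \<open>ts_kappa T\<close>, where \<open>v\<close> lives. If its maximum
  is right-scattered in \<open>T\<close>, the derivative of \<open>y\<close> on \<open>T\<close> gives no derivative on
  \<open>ts_kappa T\<close> there, but it still gives continuity.
\<close>

lemma solution_factor:
  fixes y v E :: "real \<Rightarrow> complex"
  assumes T: "closed T" and t: "t \<in> ts_kappa T" "t0 \<in> ts_kappa T" "t0 \<le> t"
    and \<kappa>0: "\<And>t. t \<in> T \<Longrightarrow> \<kappa>0 \<alpha> t \<noteq> 0"
    and sol: "solves_equation T \<kappa>0 \<kappa>1 \<alpha> a b t0 y v"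
    and E: "\<And>t. t \<in> ts_kappa T \<Longrightarrow>
      has_delta_derivative (ts_kappa T) E (exp_quotient \<kappa>0 \<kappa>1 \<alpha> lam' t * E t) t"
    and nz: "\<And>t. E t \<noteq> 0" and E0: "E t0 = 1"
    and lam: "of_real a = - (lam + lam')" "of_real b = lam * lam'"
  shows "v t - lam * y t = (v t0 - lam * y t0) * E t"
proof -
  define S where "S = ts_kappa T \<inter> {t0..}"
  have S: "closed S" unfolding S_def using closed_ts_kappa[OF T] by auto
  have ST: "S \<subseteq> T" using ts_kappa_subset by (auto simp: S_def)
  have cont: "continuous (at x within S) y" "continuous (at x within S) v"
      "continuous (at x within S) E" if x: "x \<in> S" for x
  proof -
    obtain d where "has_delta_derivative (T \<inter> {t0..}) y d x"
      using sol x unfolding solves_equation_def has_alpha_derivative_def S_def by blast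
    then have "continuous (at x within T \<inter> {t0..}) y"
      using x ST by (intro has_delta_derivative_continuous) (auto simp: S_def)
    then show "continuous (at x within S) y"
      by (rule continuous_within_subset) (use ST in \<open>auto simp: S_def\<close>)
    have "continuous (at x within ts_kappa T) E"
      using x E[of x] by (intro has_delta_derivative_continuous) (auto simp: S_def)
    then show "continuous (at x within S) E"
      by (rule continuous_within_subset) (auto simp: S_def)
    show "continuous (at x within S) v"
    proof (cases "x \<in> ts_kappa (ts_kappa T)")
      case True
      then obtain d where "has_delta_derivative S v d x"
        using sol x unfolding solves_equation_def has_alpha_derivative_def S_def by blast
      then show ?thesis using has_delta_derivative_continuous[OF x] by blast
    next
      case False
      then have "at x within ts_kappa T = bot"
        using x by (intro not_in_ts_kappa_isolated) (auto simp: S_def)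
      moreover have "at x within S \<le> at x within ts_kappa T"
        by (rule at_le) (auto simp: S_def)
      ultimately have "at x within S = bot" by (simp add: bot.extremum_unique)
      then show ?thesis by (simp add: continuous_bot)
    qed
  qed
  have "(v t - lam * y t) / E t = (v t0 - lam * y t0) / E t0"
  proof (rule first_order_ratio_constant[OF S, where q = "exp_quotient \<kappa>0 \<kappa>1 \<alpha> lam'"])
    show "t0 \<in> S" "t \<in> S" using t by (auto simp: S_def)
    show "continuous_on S (\<lambda>t. v t - lam * y t)" "continuous_on S E"
      unfolding continuous_on_eq_continuous_within using cont by (auto intro!: continuous_intros)
    fix x z assume x: "x \<in> S" "t0 \<le> x" "z \<in> S" "x < z"
    then have xk: "x \<in> ts_kappa T" "z \<in> ts_kappa T" "x \<in> T" using ST by (auto simp: S_def)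
    have sig: "sigma S x = sigma (ts_kappa T) x" "sigma S x = sigma (T \<inter> {t0..}) x"
      using sigma_half_line[OF xk(1) x(2)] sigma_half_line[OF xk(3) x(2)]
        sigma_ts_kappa[OF xk(2) x(4)] by (auto simp: S_def)
    show "has_delta_derivative S E (exp_quotient \<kappa>0 \<kappa>1 \<alpha> lam' x * E x) x"
      using sig by (intro has_delta_derivative_subset[OF E[OF xk(1)]]) (auto simp: S_def)
    obtain d where d: "has_delta_derivative (T \<inter> {t0..}) y d x"
      "v x = of_real (\<kappa>1 \<alpha> x) * y x + of_real (\<kappa>0 \<alpha> x) * d"
      using sol x unfolding solves_equation_def has_alpha_derivative_def S_def by blast
    have dS: "has_delta_derivative S y d x"
      using sig ST by (intro has_delta_derivative_subset[OF d(1)]) (auto simp: S_def)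
    have "x \<in> ts_kappa (ts_kappa T)" using later_in_ts_kappa[OF xk(1,2) x(4)] .
    then obtain d' where d': "has_delta_derivative S v d' x"
      "of_real (\<kappa>1 \<alpha> x) * v x + of_real (\<kappa>0 \<alpha> x) * d' + of_real a * v x + of_real b * y x = 0"
      using sol x unfolding solves_equation_def has_alpha_derivative_def S_def by blast
    let ?k0 = "of_real (\<kappa>0 \<alpha> x) :: complex" and ?k1 = "of_real (\<kappa>1 \<alpha> x) :: complex"
    have k0: "?k0 \<noteq> 0" using \<kappa>0[OF xk(3)] by simp
    have k0d: "?k0 * d = v x - ?k1 * y x" "?k0 * d' = (lam + lam' - ?k1) * v x - lam * lam' * y x"
      using d(2) d'(2) unfolding lam by (simp, simp add: algebra_simps eq_neg_iff_add_eq_0)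
    have "?k0 * (d' - lam * d) = ?k0 * d' - lam * (?k0 * d)" by (simp add: algebra_simps)
    also have "\<dots> = (lam' - ?k1) * (v x - lam * y x)" unfolding k0d by (simp add: algebra_simps)
    finally have "?k0 * (d' - lam * d) = (lam' - ?k1) * (v x - lam * y x)" .
    then have "1 * d' + - lam * d = exp_quotient \<kappa>0 \<kappa>1 \<alpha> lam' x * (v x - lam * y x)"
      using k0 by (simp add: exp_quotient_def field_simps)
    then show "has_delta_derivative S (\<lambda>t. v t - lam * y t)
        (exp_quotient \<kappa>0 \<kappa>1 \<alpha> lam' x * (v x - lam * y x)) x"
      using has_delta_derivative_linear[OF x(1) d'(1) dS, of 1 "- lam"] by simp
  qed (use t nz in auto)
  then show ?thesis using nz[of t] E0 by (simp add: field_simps)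
qed

theorem theorem3p20:
  fixes T :: "real set" and \<kappa>0 \<kappa>1 :: "real \<Rightarrow> real \<Rightarrow> real"
    and \<alpha> t0 a b :: real and y0 y0\<alpha> lam1 lam2 r :: complex
    and E1 E2 Y :: "real \<Rightarrow> complex"
  assumes "time_scale T" and "\<alpha> \<in> {0<..1}" and "t0 \<in> T"
    and "admissible_pair T \<kappa>0 \<kappa>1"
    and "regressive_equation T \<kappa>0 \<kappa>1 \<alpha> a b"
    and "a\<^sup>2 - 4 * b \<noteq> 0"
    and r: "r = csqrt (of_real (a\<^sup>2 - 4 * b))"
    and lam1: "lam1 = (- of_real a - r) / 2"
    and lam2: "lam2 = (- of_real a + r) / 2"
    and "rd_continuous T (exp_quotient \<kappa>0 \<kappa>1 \<alpha> lam1)"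
    and "rd_continuous T (exp_quotient \<kappa>0 \<kappa>1 \<alpha> lam2)"
    and "continuous_at_left_dense_end T (\<kappa>0 \<alpha>)"
    and "continuous_at_left_dense_end T (\<kappa>1 \<alpha>)"
    and E1: "E1 = (\<lambda>t. alpha_exp T \<kappa>0 \<kappa>1 \<alpha> lam1 t t0)"
    and E2: "E2 = (\<lambda>t. alpha_exp T \<kappa>0 \<kappa>1 \<alpha> lam2 t t0)"
    and Y: "Y = (\<lambda>t. y0 * ((E1 t + E2 t) / 2)
                    + (of_real a * y0 + 2 * y0\<alpha>) / r * ((E2 t - E1 t) / 2))"
  shows "fundamental_system T \<kappa>0 \<kappa>1 \<alpha> a b t0 E1 E2 \<and>
         solves_ivp T \<kappa>0 \<kappa>1 \<alpha> a b t0 y0 y0\<alpha> Y \<and>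
         (\<forall>y. solves_ivp T \<kappa>0 \<kappa>1 \<alpha> a b t0 y0 y0\<alpha> y \<longrightarrow>
              (\<forall>t \<in> ts_kappa (ts_kappa T) \<inter> {t0..}. y t = Y t))"
proof -
  have T: "closed T" using assms(1) by (simp add: time_scale_def)
  have \<kappa>0: "\<kappa>0 \<alpha> t \<noteq> 0" if "t \<in> T" for t
    using assms(2,4) that by (auto simp: admissible_pair_def)
  have r2: "r\<^sup>2 = of_real (a\<^sup>2 - 4 * b)" unfolding r by simp
  have r0: "r \<noteq> 0" using r2 assms(6) by (metis of_real_eq_0_iff power_zero_numeral)
  have vieta: "of_real a = - (lam1 + lam2)" "of_real b = lam1 * lam2"
  proof -
    show "of_real a = - (lam1 + lam2)" unfolding lam1 lam2 by (simp add: field_simps)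
    have "lam1 * lam2 = ((of_real a)\<^sup>2 - r\<^sup>2) / 4"
      unfolding lam1 lam2 by (simp add: field_simps power2_eq_square)
    then show "of_real b = lam1 * lam2" unfolding r2 by simp
  qed
  have diff: "lam2 - lam1 = r" unfolding lam1 lam2 by (simp add: field_simps)
  have regr: "1 + of_real (graininess T t) * exp_quotient \<kappa>0 \<kappa>1 \<alpha> lam1 t \<noteq> 0 \<and>
      1 + of_real (graininess T t) * exp_quotient \<kappa>0 \<kappa>1 \<alpha> lam2 t \<noteq> 0" if t: "t \<in> ts_kappa T" for t
  proof -
    define k0 k1 m :: complex
      where "k0 = of_real (\<kappa>0 \<alpha> t)" and "k1 = of_real (\<kappa>1 \<alpha> t)" and "m = of_real (graininess T t)"
    have k0: "k0 \<noteq> 0" using \<kappa>0 t ts_kappa_subset[of T] by (auto simp: k0_def)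
    have "of_real ((\<kappa>0 \<alpha> t)\<^sup>2 - graininess T t * \<kappa>0 \<alpha> t * (a + 2 * \<kappa>1 \<alpha> t)
          + (graininess T t)\<^sup>2 * (b + a * \<kappa>1 \<alpha> t + (\<kappa>1 \<alpha> t)\<^sup>2)) \<noteq> (0::complex)"
      using assms(5) t unfolding regressive_equation_def of_real_eq_0_iff by blast
    then have "k0\<^sup>2 - m * k0 * (of_real a + 2 * k1) + m\<^sup>2 * (of_real b + of_real a * k1 + k1\<^sup>2) \<noteq> 0"
      by (simp add: k0_def k1_def m_def)
    moreover have "k0\<^sup>2 - m * k0 * (of_real a + 2 * k1) + m\<^sup>2 * (of_real b + of_real a * k1 + k1\<^sup>2)
        = (k0 + m * (lam1 - k1)) * (k0 + m * (lam2 - k1))"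
      unfolding vieta by (simp add: algebra_simps power2_eq_square)
    ultimately have "k0 + m * (lam1 - k1) \<noteq> 0" "k0 + m * (lam2 - k1) \<noteq> 0" by auto
    moreover have "k0 + m * (l - k1) = k0 * (1 + m * exp_quotient \<kappa>0 \<kappa>1 \<alpha> l t)" for l
      using k0 by (simp add: exp_quotient_def k0_def k1_def field_simps)
    ultimately show ?thesis by (auto simp: m_def)
  qed
  have q_end: "continuous_at_left_dense_end T (exp_quotient \<kappa>0 \<kappa>1 \<alpha> lam)" for lam
    unfolding continuous_at_left_dense_end_def
  proof (intro allI impI)
    fix m assume m: "is_maximum (ts_kappa T) m \<and> left_dense T m"
    then have "m \<in> T" by (simp add: left_dense_def)
    then show "continuous (at m within T) (exp_quotient \<kappa>0 \<kappa>1 \<alpha> lam)"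
      using assms(12,13) m \<kappa>0 unfolding continuous_at_left_dense_end_def exp_quotient_def[abs_def]
      by (intro continuous_divide continuous_intros) auto
  qed
  note exp1 = T assms(3) assms(10) q_end[of lam1] regr[THEN conjunct1]
  note exp2 = T assms(3) assms(11) q_end[of lam2] regr[THEN conjunct2]
  have E1': "E1 = (\<lambda>t. ts_exp T (exp_quotient \<kappa>0 \<kappa>1 \<alpha> lam1) t t0)"
    and E2': "E2 = (\<lambda>t. ts_exp T (exp_quotient \<kappa>0 \<kappa>1 \<alpha> lam2) t t0)"
    unfolding E1 E2 alpha_exp_def by auto
  have E_nz: "E1 t \<noteq> 0" "E2 t \<noteq> 0" for t unfolding E1' E2' ts_exp_def by auto
  have E_t0: "E1 t0 = 1" "E2 t0 = 1"
    unfolding E1' E2' using ts_exp_self[OF exp1] ts_exp_self[OF exp2] by auto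
  have sol1: "solves_equation T \<kappa>0 \<kappa>1 \<alpha> a b t0 E1 (\<lambda>t. lam1 * E1 t)"
    unfolding E1'
    by (rule characteristic_root_solves[OF \<kappa>0 ts_exp_delta_derivative[OF exp1]
          ts_exp_delta_derivative_kappa[OF exp1]])
      (simp_all add: vieta power2_eq_square algebra_simps)
  have sol2: "solves_equation T \<kappa>0 \<kappa>1 \<alpha> a b t0 E2 (\<lambda>t. lam2 * E2 t)"
    unfolding E2'
    by (rule characteristic_root_solves[OF \<kappa>0 ts_exp_delta_derivative[OF exp2]
          ts_exp_delta_derivative_kappa[OF exp2]])
      (simp_all add: vieta power2_eq_square algebra_simps)
  \<comment> \<open>The coefficients with \<open>c1 + c2 = y0\<close> and \<open>c1 * lam1 + c2 * lam2 = y0\<alpha>\<close>.\<close>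
  define c1 where "c1 = (lam2 * y0 - y0\<alpha>) / r"
  define c2 where "c2 = (y0\<alpha> - lam1 * y0) / r"
  have Y': "Y = (\<lambda>t. c1 * E1 t + c2 * E2 t)"
  proof
    fix t
    define k where "k = (of_real a * y0 + 2 * y0\<alpha>) / r"
    have c12: "c1 = (y0 - k) / 2" "c2 = (y0 + k) / 2"
      unfolding c1_def c2_def k_def lam1 lam2 using r0 by (simp_all add: field_simps)
    show "Y t = c1 * E1 t + c2 * E2 t"
      unfolding Y k_def[symmetric] c12 by (simp add: field_simps)
  qed
  have "c1 + c2 = (lam2 - lam1) * y0 / r" "c1 * lam1 + c2 * lam2 = (lam2 - lam1) * y0\<alpha> / r"
    unfolding c1_def c2_def using r0 by (simp_all add: field_simps)
  then have c: "c1 + c2 = y0" "c1 * lam1 + c2 * lam2 = y0\<alpha>" using r0 by (simp_all add: diff)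
  have "fundamental_system T \<kappa>0 \<kappa>1 \<alpha> a b t0 E1 E2"
    unfolding fundamental_system_def
  proof (intro exI conjI ballI)
    fix t
    have "E1 t * (lam2 * E2 t) - E2 t * (lam1 * E1 t) = (lam2 - lam1) * (E1 t * E2 t)"
      by (simp add: algebra_simps)
    then show "E1 t * (lam2 * E2 t) - E2 t * (lam1 * E1 t) \<noteq> 0" using diff r0 E_nz by simp
  qed (rule sol1 sol2)+
  moreover have "solves_ivp T \<kappa>0 \<kappa>1 \<alpha> a b t0 y0 y0\<alpha> Y"
    unfolding solves_ivp_def Y'
    by (rule exI, intro conjI, rule solves_equation_linear[OF sol1 sol2, of c1 c2])
      (simp_all add: E_t0 c mult.commute)
  moreover have "y t = Y t"
    if y: "solves_ivp T \<kappa>0 \<kappa>1 \<alpha> a b t0 y0 y0\<alpha> y" and t: "t \<in> ts_kappa (ts_kappa T) \<inter> {t0..}" for y t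
  proof -
    obtain v where sol: "solves_equation T \<kappa>0 \<kappa>1 \<alpha> a b t0 y v" and init: "y t0 = y0" "v t0 = y0\<alpha>"
      using y unfolding solves_ivp_def by blast
    have tk: "t \<in> ts_kappa T" "t0 \<le> t" using t ts_kappa_subset by auto
    then have t0k: "t0 \<in> ts_kappa T"
      using later_in_ts_kappa[OF assms(3), of t] ts_kappa_subset[of T] by (cases "t0 = t") auto
    note factor = solution_factor[OF T tk(1) t0k tk(2) \<kappa>0 sol]
    have u2: "v t - lam1 * y t = (v t0 - lam1 * y t0) * E2 t"
      by (rule factor[where lam' = lam2])
        (use E_nz E_t0 vieta ts_exp_delta_derivative_kappa[OF exp2] in \<open>auto simp: E2'\<close>)
    have u1: "v t - lam2 * y t = (v t0 - lam2 * y t0) * E1 t"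
      by (rule factor[where lam' = lam1])
        (use E_nz E_t0 vieta ts_exp_delta_derivative_kappa[OF exp1] in \<open>auto simp: E1'\<close>)
    have "(lam2 - lam1) * y t = (v t - lam1 * y t) - (v t - lam2 * y t)" by (simp add: algebra_simps)
    also have "\<dots> = (y0\<alpha> - lam1 * y0) * E2 t - (y0\<alpha> - lam2 * y0) * E1 t"
      unfolding u1 u2 init ..
    finally have ry: "r * y t = (y0\<alpha> - lam1 * y0) * E2 t - (y0\<alpha> - lam2 * y0) * E1 t"
      unfolding diff .
    have "r * c1 = lam2 * y0 - y0\<alpha>" "r * c2 = y0\<alpha> - lam1 * y0"
      unfolding c1_def c2_def using r0 by simp_all
    then have "r * Y t = (lam2 * y0 - y0\<alpha>) * E1 t + (y0\<alpha> - lam1 * y0) * E2 t"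
      unfolding Y' by (simp only: distrib_left mult.assoc[symmetric])
    then have "r * y t = r * Y t" unfolding ry by (simp add: left_diff_distrib)
    then show "y t = Y t" using r0 by simp
  qed
  ultimately show ?thesis by blast
qed

end
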